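(* Let $\mathcal P$ be a nonempty convex set of probability measures on a measurable space $(\mathcal X,\mathcal F)$ that is dominated by a $\sigma$-finite measure, and let $\theta:\mathcal P\to\mathbb R$ be linear, i.e. $\theta(\lambda P_0+(1-\lambda)P_1)=\lambda\theta(P_0)+(1-\lambda)\theta(P_1)$ for $P_0,P_1\in\mathcal P$, $\lambda\in[0,1]$. For $\alpha\in(0,\infty)$ and $\ell\in L_\infty(\mathcal X)$ let $Q_1^{(\alpha,\ell)}$ be the binary $\alpha$-private channel defined in the context. Then $$\inf_{\ell:\|\ell\|_\infty\le1}\omega_H^{(Q_1^{(\alpha,\ell)})}(\varepsilon)\;\le\;\omega_{TV}\left(\left[\varepsilon\,\frac{e^\alpha+1}{e^\alpha-1}\right]^+\right)\qquad\text{for all }\varepsilon>0.$$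
   Context: $L_\infty(\mathcal X)$ is the set of bounded measurable functions $\ell:\mathcal X\to\mathbb R$ with supremum norm $\|\ell\|_\infty$. Binary channel: with $z_0=\|\ell\|_\infty\frac{e^\alpha+1}{e^\alpha-1}$, $Q_1^{(\alpha,\ell)}$ is the Markov kernel from $\mathcal X$ to $\{-z_0,z_0\}\subset\mathbb R$ given by $Q_1^{(\alpha,\ell)}(\{\pm z_0\}|x)=\frac12\big(1\pm\frac{\ell(x)}{z_0}\big)$ (for $\ell\equiv0$ it is the point mass at $0$ for every $x$). For a Markov kernel $Q_1$ and probability measure $P$, $Q_1P(A)=\int Q_1(A|x)\,dP(x)$. Distances: $d_{TV}(P_0,P_1)=\sup_A|P_0(A)-P_1(A)|$, $d_H(P_0,P_1)=\big(\int(\sqrt{p_0}-\sqrt{p_1})^2d\mu\big)^{1/2}$ with $p_j$ densities with respect to a dominating $\mu$. Moduli: $\omega_{TV}(\varepsilon)=\sup\{|\theta(P_0)-\theta(P_1)|:d_{TV}(P_0,P_1)\le\varepsilon,\ P_0,P_1\in\mathcal P\}$ and $\omega_H^{(Q_1)}(\varepsilon)=\sup\{|\theta(P_0)-\theta(P_1)|:d_H(Q_1P_0,Q_1P_1)\le\varepsilon,\ P_0,P_1\in\mathcal P\}$. For monotone $g$, $g(x^+)=\lim_{y\downarrow x}g(y)$. *)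

theory Defs
  imports "HOL-Probability.Probability"
begin

definition mixture :: "real \<Rightarrow> 'a measure \<Rightarrow> 'a measure \<Rightarrow> 'a measure" where
  "mixture r P Q =
     measure_of (space P) (sets P)
       (\<lambda>A. ennreal r * emeasure P A + ennreal (1 - r) * emeasure Q A)"

lemma space_mixture [simp]: "space (mixture r P Q) = space P"
  by (simp add: mixture_def)

lemma sets_mixture [simp, measurable_cong]: "sets (mixture r P Q) = sets P"
  by (simp add: mixture_def)

lemma emeasure_mixture:
  assumes "sets Q = sets P" "A \<in> sets P"
  shows "emeasure (mixture r P Q) A = ennreal r * emeasure P A + ennreal (1 - r) * emeasure Q A"
  unfolding mixture_def
proof (rule emeasure_measure_of_sigma)
  show "sigma_algebra (space P) (sets P)" ..
  show "positive (sets P) (\<lambda>A. ennreal r * emeasure P A + ennreal (1 - r) * emeasure Q A)"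
    by (simp add: positive_def)
  show "countably_additive (sets P)
          (\<lambda>A. ennreal r * emeasure P A + ennreal (1 - r) * emeasure Q A)"
  proof (rule countably_additiveI)
    fix F :: "nat \<Rightarrow> 'a set"
    assume F: "range F \<subseteq> sets P" "disjoint_family F"
    have "(\<Sum>i. emeasure P (F i)) = emeasure P (\<Union>i. F i)"
      "(\<Sum>i. emeasure Q (F i)) = emeasure Q (\<Union>i. F i)"
      using F assms by (auto intro!: suminf_emeasure)
    then show "(\<Sum>i. ennreal r * emeasure P (F i) + ennreal (1 - r) * emeasure Q (F i)) =
        ennreal r * emeasure P (\<Union> (range F)) + ennreal (1 - r) * emeasure Q (\<Union> (range F))"
      by (simp add: suminf_add[symmetric])
  qed
qed fact

lemma prob_space_mixture:
  assumes "prob_space P" "prob_space Q" "sets Q = sets P" "0 \<le> r" "r \<le> 1"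
  shows "prob_space (mixture r P Q)"
proof (rule prob_spaceI)
  have "space Q = space P" using assms(3) by (rule sets_eq_imp_space_eq)
  then have "emeasure P (space P) = 1" "emeasure Q (space P) = 1"
    using prob_space.emeasure_space_1[OF assms(1)] prob_space.emeasure_space_1[OF assms(2)] by auto
  then show "emeasure (mixture r P Q) (space (mixture r P Q)) = 1"
    using assms by (simp add: emeasure_mixture flip: ennreal_plus)
qed

definition convex_family :: "'a measure set \<Rightarrow> bool" where
  "convex_family \<P> \<longleftrightarrow>
     (\<forall>P0\<in>\<P>. \<forall>P1\<in>\<P>. \<forall>r\<in>{0..1}. mixture r P0 P1 \<in> \<P>)"

definition linear_functional_on :: "'a measure set \<Rightarrow> ('a measure \<Rightarrow> real) \<Rightarrow> bool" where
  "linear_functional_on \<P> \<theta> \<longleftrightarrow>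
     (\<forall>P0\<in>\<P>. \<forall>P1\<in>\<P>. \<forall>r\<in>{0..1}. \<theta> (mixture r P0 P1) = r * \<theta> P0 + (1 - r) * \<theta> P1)"

definition tv_dist :: "'a measure \<Rightarrow> 'a measure \<Rightarrow> real" where
  "tv_dist P0 P1 = (SUP A\<in>sets P0. \<bar>measure P0 A - measure P1 A\<bar>)"

definition densities_wrt ::
    "'a measure \<Rightarrow> 'a measure \<Rightarrow> 'a measure \<Rightarrow> ('a \<Rightarrow> real) \<Rightarrow> ('a \<Rightarrow> real) \<Rightarrow> bool" where
  "densities_wrt P0 P1 \<mu> p0 p1 \<longleftrightarrow>
     sigma_finite_measure \<mu> \<and> p0 \<in> borel_measurable \<mu> \<and> p1 \<in> borel_measurable \<mu> \<and>
     (\<forall>x\<in>space \<mu>. 0 \<le> p0 x \<and> 0 \<le> p1 x) \<and> P0 = density \<mu> p0 \<and> P1 = density \<mu> p1"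

text \<open>The value depends neither on the dominating measure nor on the versions of the densities,
  see \<open>hellinger_dist_eq\<close>; a dominating measure exists by \<open>densities_wrt_exist\<close>.
  There is no factor 1/2 in front of the integral.\<close>

definition hellinger_dist :: "'a measure \<Rightarrow> 'a measure \<Rightarrow> real" where
  "hellinger_dist P0 P1 =
     (THE d. \<exists>\<mu> p0 p1. densities_wrt P0 P1 \<mu> p0 p1 \<and>
        d = sqrt (LINT x|\<mu>. (sqrt (p0 x) - sqrt (p1 x))\<^sup>2))"

lemma densities_wrt_sum:
  assumes "densities_wrt P0 P1 \<mu> p0 p1"
  defines "S \<equiv> density \<mu> (\<lambda>x. ennreal (p0 x + p1 x))"
  defines "g0 \<equiv> \<lambda>x. p0 x / (p0 x + p1 x)" and "g1 \<equiv> \<lambda>x. p1 x / (p0 x + p1 x)"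
  shows "P0 = density S g0" "P1 = density S g1"
    and "(LINT x|\<mu>. (sqrt (p0 x) - sqrt (p1 x))\<^sup>2) = (LINT x|S. (sqrt (g0 x) - sqrt (g1 x))\<^sup>2)"
    and "g0 \<in> borel_measurable S" "g1 \<in> borel_measurable S"
    and "\<And>x. x \<in> space S \<Longrightarrow> 0 \<le> g0 x \<and> 0 \<le> g1 x"
    and "sets S = sets P0" "\<And>A. A \<in> sets P0 \<Longrightarrow> emeasure S A = emeasure P0 A + emeasure P1 A"
proof -
  have m[measurable]: "p0 \<in> borel_measurable \<mu>" "p1 \<in> borel_measurable \<mu>"
    and nn: "\<And>x. x \<in> space \<mu> \<Longrightarrow> 0 \<le> p0 x" "\<And>x. x \<in> space \<mu> \<Longrightarrow> 0 \<le> p1 x"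
    and P: "P0 = density \<mu> p0" "P1 = density \<mu> p1"
    using assms(1) by (auto simp: densities_wrt_def)
  have eq: "(p0 x + p1 x) * g0 x = p0 x" "(p0 x + p1 x) * g1 x = p1 x" if "x \<in> space \<mu>" for x
    using nn[OF that] by (auto simp: g0_def g1_def add_nonneg_eq_0_iff)
  show gm: "g0 \<in> borel_measurable S" "g1 \<in> borel_measurable S"
    by (simp_all add: g0_def g1_def S_def)
  then have gm'[measurable]: "g0 \<in> borel_measurable \<mu>" "g1 \<in> borel_measurable \<mu>"
    by (simp_all add: S_def)
  show gnn: "\<And>x. x \<in> space S \<Longrightarrow> 0 \<le> g0 x \<and> 0 \<le> g1 x"
    using nn by (auto simp: g0_def g1_def S_def)
  have "density S g0 = density \<mu> (\<lambda>x. ennreal (p0 x + p1 x) * ennreal (g0 x))"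
    "density S g1 = density \<mu> (\<lambda>x. ennreal (p0 x + p1 x) * ennreal (g1 x))"
    unfolding S_def by (simp_all add: density_density_eq)
  moreover have "ennreal (p0 x + p1 x) * ennreal (g0 x) = p0 x"
    "ennreal (p0 x + p1 x) * ennreal (g1 x) = p1 x" if "x \<in> space \<mu>" for x
    using nn[OF that] eq[OF that] by (metis ennreal_mult' add_nonneg_nonneg)+
  ultimately show "P0 = density S g0" "P1 = density S g1"
    unfolding P by (auto intro!: density_cong)
  show "sets S = sets P0"
    by (simp add: S_def P)
  show "emeasure S A = emeasure P0 A + emeasure P1 A" if "A \<in> sets P0" for A
  proof -
    have [measurable]: "A \<in> sets \<mu>" using that by (simp add: P)
    have "emeasure S A = (\<integral>\<^sup>+x. ennreal (p0 x) * indicator A x + ennreal (p1 x) * indicator A x \<partial>\<mu>)"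
      unfolding S_def using nn
      by (subst emeasure_density) (auto intro!: nn_integral_cong simp: distrib_right)
    then show ?thesis
      unfolding P by (simp add: emeasure_density nn_integral_add)
  qed
  have "(p0 x + p1 x) * (sqrt (g0 x) - sqrt (g1 x))\<^sup>2 = (sqrt (p0 x) - sqrt (p1 x))\<^sup>2"
    if "x \<in> space \<mu>" for x
  proof -
    have s: "0 \<le> p0 x + p1 x" using nn[OF that] by simp
    have "(p0 x + p1 x) * (sqrt (g0 x) - sqrt (g1 x))\<^sup>2 =
        (sqrt (p0 x + p1 x) * (sqrt (g0 x) - sqrt (g1 x)))\<^sup>2"
      using s by (simp add: power_mult_distrib)
    also have "\<dots> = (sqrt ((p0 x + p1 x) * g0 x) - sqrt ((p0 x + p1 x) * g1 x))\<^sup>2"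
      by (simp add: right_diff_distrib real_sqrt_mult)
    finally show ?thesis using eq[OF that] by simp
  qed
  then show "(LINT x|\<mu>. (sqrt (p0 x) - sqrt (p1 x))\<^sup>2) = (LINT x|S. (sqrt (g0 x) - sqrt (g1 x))\<^sup>2)"
    unfolding S_def using nn
    by (subst integral_density) (auto intro!: Bochner_Integration.integral_cong AE_I2)
qed

lemma densities_wrt_unique:
  assumes fin: "finite_measure P0" "finite_measure P1"
    and p: "densities_wrt P0 P1 \<mu> p0 p1" and q: "densities_wrt P0 P1 \<nu> q0 q1"
  shows "(LINT x|\<mu>. (sqrt (p0 x) - sqrt (p1 x))\<^sup>2) = (LINT x|\<nu>. (sqrt (q0 x) - sqrt (q1 x))\<^sup>2)"
proof -
  define S where "S = density \<mu> (\<lambda>x. ennreal (p0 x + p1 x))"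
  define T where "T = density \<nu> (\<lambda>x. ennreal (q0 x + q1 x))"
  let ?g0 = "(\<lambda>x. p0 x / (p0 x + p1 x))"
  let ?g1 = "(\<lambda>x. p1 x / (p0 x + p1 x))"
  let ?h0 = "(\<lambda>x. q0 x / (q0 x + q1 x))"
  let ?h1 = "(\<lambda>x. q1 x / (q0 x + q1 x))"
  note A = densities_wrt_sum[OF p, folded S_def]
  note B = densities_wrt_sum[OF q, folded T_def]
  have "T = S"
  proof (rule measure_eqI)
    show "sets T = sets S" by (simp only: A(7) B(7))
    show "emeasure T X = emeasure S X" if "X \<in> sets T" for X
      using that unfolding B(7) by (simp only: A(8) B(8))
  qed
  note B = B[unfolded this]
  have P1: "sets P1 = sets P0"
    using p by (auto simp: densities_wrt_def)
  have "finite_measure S"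
  proof
    have "space S = space P0" "space P1 = space P0"
      by (rule sets_eq_imp_space_eq, fact A(7) P1)+
    then show "emeasure S (space S) \<noteq> \<infinity>"
      using A(8)[of "space P0"] finite_measure.emeasure_finite[OF fin(1), of "space P0"]
        finite_measure.emeasure_finite[OF fin(2), of "space P0"] by simp
  qed
  then interpret S: finite_measure S .
  have [measurable]: "?g0 \<in> borel_measurable S" "?g1 \<in> borel_measurable S"
    "?h0 \<in> borel_measurable S" "?h1 \<in> borel_measurable S"
    by (fact A(4) A(5) B(4) B(5))+
  have "density S ?g0 = density S ?h0" "density S ?g1 = density S ?h1"
    using A(1,2) B(1,2) by metis+
  then have "AE x in S. ennreal (?g0 x) = ennreal (?h0 x)" "AE x in S. ennreal (?g1 x) = ennreal (?h1 x)"
    by (auto intro!: S.density_unique)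
  moreover have "AE x in S. 0 \<le> ?g0 x \<and> 0 \<le> ?g1 x \<and> 0 \<le> ?h0 x \<and> 0 \<le> ?h1 x"
    by (rule AE_I2) (use A(6) B(6) in blast)
  ultimately have "AE x in S. (sqrt (?g0 x) - sqrt (?g1 x))\<^sup>2 = (sqrt (?h0 x) - sqrt (?h1 x))\<^sup>2"
    by eventually_elim simp
  then have "(LINT x|S. (sqrt (?g0 x) - sqrt (?g1 x))\<^sup>2) = (LINT x|S. (sqrt (?h0 x) - sqrt (?h1 x))\<^sup>2)"
    by (intro integral_cong_AE) measurable
  then show ?thesis by (simp only: A(3) B(3))
qed

lemma hellinger_dist_eq:
  assumes "finite_measure P0" "finite_measure P1" "densities_wrt P0 P1 \<mu> p0 p1"
  shows "hellinger_dist P0 P1 = sqrt (LINT x|\<mu>. (sqrt (p0 x) - sqrt (p1 x))\<^sup>2)"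
  unfolding hellinger_dist_def
proof (rule the_equality)
  show "\<exists>\<nu> q0 q1. densities_wrt P0 P1 \<nu> q0 q1 \<and>
      sqrt (LINT x|\<mu>. (sqrt (p0 x) - sqrt (p1 x))\<^sup>2) = sqrt (LINT x|\<nu>. (sqrt (q0 x) - sqrt (q1 x))\<^sup>2)"
    using assms(3) by blast
  fix d
  assume "\<exists>\<nu> q0 q1. densities_wrt P0 P1 \<nu> q0 q1 \<and>
      d = sqrt (LINT x|\<nu>. (sqrt (q0 x) - sqrt (q1 x))\<^sup>2)"
  then obtain \<nu> q0 q1 where "densities_wrt P0 P1 \<nu> q0 q1"
    and d: "d = sqrt (LINT x|\<nu>. (sqrt (q0 x) - sqrt (q1 x))\<^sup>2)"
    by blast
  then show "d = sqrt (LINT x|\<mu>. (sqrt (p0 x) - sqrt (p1 x))\<^sup>2)"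
    unfolding d using densities_wrt_unique[OF assms(1,2) _ assms(3)] by simp
qed

lemma densities_wrt_exist:
  assumes "prob_space P0" "prob_space P1" "sets P1 = sets P0"
  shows "\<exists>\<mu> p0 p1. densities_wrt P0 P1 \<mu> p0 p1"
proof -
  define \<mu> where "\<mu> = mixture (1/2) P0 P1"
  interpret P0: prob_space P0 by fact
  interpret P1: prob_space P1 by fact
  interpret m: prob_space \<mu>
    unfolding \<mu>_def using assms by (intro prob_space_mixture) auto
  have e: "emeasure \<mu> A = ennreal (1/2) * emeasure P0 A + ennreal (1/2) * emeasure P1 A"
    if "A \<in> sets \<mu>" for A
    using that assms emeasure_mixture[of P1 P0 A "1/2"] by (simp add: \<mu>_def)
  have "P0 = density \<mu> (\<lambda>x. ennreal (enn2real (RN_deriv \<mu> P0 x)))"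
    and "P1 = density \<mu> (\<lambda>x. ennreal (enn2real (RN_deriv \<mu> P1 x)))"
  proof -
    have ac: "absolutely_continuous \<mu> P0" "absolutely_continuous \<mu> P1"
      using assms e by (auto simp: absolutely_continuous_def null_sets_def \<mu>_def)
    have s: "sets P0 = sets \<mu>" "sets P1 = sets \<mu>"
      using assms by (auto simp: \<mu>_def)
    have "AE x in \<mu>. RN_deriv \<mu> P0 x \<noteq> \<infinity>" "AE x in \<mu>. RN_deriv \<mu> P1 x \<noteq> \<infinity>"
      by (rule m.RN_deriv_finite; use ac s P0.sigma_finite_measure_axioms
          P1.sigma_finite_measure_axioms in auto)+
    then have "density \<mu> (\<lambda>x. ennreal (enn2real (RN_deriv \<mu> P0 x))) = density \<mu> (RN_deriv \<mu> P0)"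
      "density \<mu> (\<lambda>x. ennreal (enn2real (RN_deriv \<mu> P1 x))) = density \<mu> (RN_deriv \<mu> P1)"
      by (auto intro!: density_cong simp: less_top)
    then show "P0 = density \<mu> (\<lambda>x. ennreal (enn2real (RN_deriv \<mu> P0 x)))"
      and "P1 = density \<mu> (\<lambda>x. ennreal (enn2real (RN_deriv \<mu> P1 x)))"
      using m.density_RN_deriv[OF ac(1) s(1)] m.density_RN_deriv[OF ac(2) s(2)] by simp_all
  qed
  then have "densities_wrt P0 P1 \<mu> (\<lambda>x. enn2real (RN_deriv \<mu> P0 x))
      (\<lambda>x. enn2real (RN_deriv \<mu> P1 x))"
    by (simp add: densities_wrt_def m.sigma_finite_measure_axioms)
  then show ?thesis by blast
qed

definition Linfty :: "'a measure \<Rightarrow> ('a \<Rightarrow> real) set" where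
  "Linfty M = {l \<in> borel_measurable M. bounded (l ` space M)}"

text \<open>A pointwise supremum, not an essential one; junk for unbounded functions.\<close>

definition sup_norm :: "'a measure \<Rightarrow> ('a \<Rightarrow> real) \<Rightarrow> real" where
  "sup_norm M l = (SUP x\<in>space M. \<bar>l x\<bar>)"

definition channel_level :: "'a measure \<Rightarrow> real \<Rightarrow> ('a \<Rightarrow> real) \<Rightarrow> real" where
  "channel_level M \<alpha> l = sup_norm M l * ((exp \<alpha> + 1) / (exp \<alpha> - 1))"

definition binary_channel :: "'a measure \<Rightarrow> real \<Rightarrow> ('a \<Rightarrow> real) \<Rightarrow> 'a \<Rightarrow> real measure" where
  "binary_channel M \<alpha> l x =
     (if \<forall>y\<in>space M. l y = 0 then return borel 0
      else let z0 = channel_level M \<alpha> l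
           in mixture ((1 + l x / z0) / 2) (return borel z0) (return borel (- z0)))"

lemma abs_le_sup_norm: "l \<in> Linfty M \<Longrightarrow> x \<in> space M \<Longrightarrow> \<bar>l x\<bar> \<le> sup_norm M l"
  unfolding sup_norm_def Linfty_def
  by (rule cSUP_upper) (auto simp: bounded_real bdd_above_def)

lemma channel_level_gt:
  assumes "l \<in> Linfty M" "0 < \<alpha>" "y \<in> space M" "l y \<noteq> 0"
  shows "0 < channel_level M \<alpha> l" "sup_norm M l < channel_level M \<alpha> l"
proof -
  have n: "0 < sup_norm M l" using abs_le_sup_norm[OF assms(1,3)] assms(4) by linarith
  moreover have "1 < (exp \<alpha> + 1) / (exp \<alpha> - 1)" using assms(2) by (simp add: field_simps)
  ultimately show "sup_norm M l < channel_level M \<alpha> l"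
    unfolding channel_level_def using mult_strict_left_mono[of 1] by fastforce
  with n show "0 < channel_level M \<alpha> l" by simp
qed

lemma channel_prob_bounds:
  assumes "l \<in> Linfty M" "0 < \<alpha>" "x \<in> space M" "y \<in> space M" "l y \<noteq> 0"
  shows "0 \<le> (1 + l x / channel_level M \<alpha> l) / 2" "(1 + l x / channel_level M \<alpha> l) / 2 \<le> 1"
  using channel_level_gt[OF assms(1,2,4,5)] abs_le_sup_norm[OF assms(1,3)]
  by (auto simp: field_simps)

lemma binary_channel_masses:
  assumes "l \<in> Linfty M" "0 < \<alpha>" "x \<in> space M" "y \<in> space M" "l y \<noteq> 0"
  defines "z0 \<equiv> channel_level M \<alpha> l"
  shows "measure (binary_channel M \<alpha> l x) {z0} = (1 + l x / z0) / 2"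
    and "measure (binary_channel M \<alpha> l x) {- z0} = (1 - l x / z0) / 2"
proof -
  have z: "0 < z0" using channel_level_gt[OF assms(1,2,4,5)] by (simp add: z0_def)
  note b = channel_prob_bounds[OF assms(1-5), folded z0_def]
  have "\<not> (\<forall>y\<in>space M. l y = 0)" using assms(4,5) by auto
  then have c: "binary_channel M \<alpha> l x =
      mixture ((1 + l x / z0) / 2) (return borel z0) (return borel (- z0))"
    by (auto simp: binary_channel_def z0_def Let_def)
  show "measure (binary_channel M \<alpha> l x) {z0} = (1 + l x / z0) / 2"
    using z b by (simp add: c measure_def emeasure_mixture)
  have "1 - (1 + l x / z0) / 2 = (1 - l x / z0) / 2" by (simp add: field_simps)
  then show "measure (binary_channel M \<alpha> l x) {- z0} = (1 - l x / z0) / 2"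
    using z b by (simp add: c measure_def emeasure_mixture)
qed

text \<open>Measurability makes \<open>emeasure_bind\<close> applicable, so that the output law
  \<open>P \<bind> binary_channel M \<alpha> l\<close> has the expected values on Borel sets.\<close>

lemma binary_channel_measurable:
  assumes l: "l \<in> Linfty M" and "0 < \<alpha>"
  shows "binary_channel M \<alpha> l \<in> measurable M (prob_algebra borel)"
proof (cases "\<forall>y\<in>space M. l y = 0")
  case True
  then have "binary_channel M \<alpha> l = (\<lambda>_. return borel 0)"
    by (auto simp: binary_channel_def)
  then show ?thesis by (simp add: space_prob_algebra prob_space_return)
next
  case False
  then obtain y where y: "y \<in> space M" "l y \<noteq> 0" by blast
  define z0 where "z0 = channel_level M \<alpha> l"
  have [measurable]: "l \<in> borel_measurable M" using l by (simp add: Linfty_def)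
  have c: "binary_channel M \<alpha> l =
      (\<lambda>x. mixture ((1 + l x / z0) / 2) (return borel z0) (return borel (- z0)))"
    using False by (auto simp: binary_channel_def z0_def Let_def fun_eq_iff)
  have pr: "prob_space (binary_channel M \<alpha> l x)" if "x \<in> space M" for x
    unfolding c using channel_prob_bounds[OF l \<open>0 < \<alpha>\<close> that y, folded z0_def]
    by (intro prob_space_mixture prob_space_return) auto
  have "binary_channel M \<alpha> l \<in> measurable M (subprob_algebra borel)"
  proof (rule measurable_subprob_algebra)
    show "subprob_space (binary_channel M \<alpha> l x)" if "x \<in> space M" for x
      using pr[OF that] by (rule prob_space_imp_subprob_space)
    show "sets (binary_channel M \<alpha> l x) = sets borel" for x
      by (simp add: c)
    show "(\<lambda>x. emeasure (binary_channel M \<alpha> l x) A) \<in> borel_measurable M"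
      if "A \<in> sets borel" for A
      using that by (simp add: c emeasure_mixture)
  qed
  then show ?thesis
    using pr by (simp add: prob_algebra_def measurable_restrict_space2_iff)
qed

lemma emeasure_bind_binary_channel:
  assumes "l \<in> Linfty M" "0 < \<alpha>" "prob_space P" "sets P = sets M" "A \<in> sets borel"
  shows "emeasure (P \<bind> binary_channel M \<alpha> l) A
    = (\<integral>\<^sup>+x. emeasure (binary_channel M \<alpha> l x) A \<partial>P)"
proof (rule emeasure_bind)
  show "space P \<noteq> {}" using assms(3) by (rule prob_space.not_empty)
  show "binary_channel M \<alpha> l \<in> measurable P (subprob_algebra borel)"
    using measurable_prob_algebraD[OF binary_channel_measurable[OF assms(1,2)]] assms(4)
    by (simp cong: measurable_cong_sets)
qed (use assms in auto)

text \<open>The moduli are extended-real valued because \<open>\<theta>\<close> may be unbounded on \<open>\<P>\<close>.\<close>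

definition omega_TV :: "'a measure set \<Rightarrow> ('a measure \<Rightarrow> real) \<Rightarrow> real \<Rightarrow> ereal" where
  "omega_TV \<P> \<theta> \<epsilon> =
     Sup {ereal \<bar>\<theta> P0 - \<theta> P1\<bar> | P0 P1. P0 \<in> \<P> \<and> P1 \<in> \<P> \<and> tv_dist P0 P1 \<le> \<epsilon>}"

definition omega_H ::
    "'a measure set \<Rightarrow> ('a measure \<Rightarrow> real) \<Rightarrow> ('a \<Rightarrow> 'b measure) \<Rightarrow> real \<Rightarrow> ereal" where
  "omega_H \<P> \<theta> Q \<epsilon> =
     Sup {ereal \<bar>\<theta> P0 - \<theta> P1\<bar> | P0 P1.
            P0 \<in> \<P> \<and> P1 \<in> \<P> \<and> hellinger_dist (P0 \<bind> Q) (P1 \<bind> Q) \<le> \<epsilon>}"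

definition right_limit :: "(real \<Rightarrow> ereal) \<Rightarrow> real \<Rightarrow> ereal" where
  "right_limit g x = Lim (at_right x) g"

lemma mono_omega_TV: "mono (omega_TV \<P> \<theta>)"
  unfolding omega_TV_def by (rule monoI, rule Sup_subset_mono) (blast intro: order_trans)

lemma tendsto_right_limit_mono:
  assumes "mono g"
  shows "(g \<longlongrightarrow> right_limit g x) (at_right x)"
proof -
  have "(g \<longlongrightarrow> (INF y\<in>{x<..}. g y)) (at_right x)"
  proof (rule order_tendstoI)
    fix a assume "a < (INF y\<in>{x<..}. g y)"
    then have "a < g y" if "x < y" for y using that by (auto intro: less_le_trans INF_lower)
    then show "\<forall>\<^sub>F y in at_right x. a < g y" by (auto simp: eventually_at_filter)
  next
    fix a assume "(INF y\<in>{x<..}. g y) < a"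
    then obtain y where y: "x < y" "g y < a" by (auto simp: INF_less_iff)
    then have "g u < a" if "u < y" for u
      using monoD[OF assms, of u y] that by (auto intro: le_less_trans)
    then show "\<forall>\<^sub>F u in at_right x. g u < a"
      using y(1) by (auto simp: eventually_at_right)
  qed
  then show ?thesis
    unfolding right_limit_def by (simp add: tendsto_Lim)
qed

end

theory Submission
  imports Defs "HOL-Library.Function_Algebras"
begin

text \<open>Let \<open>c = (e\<^sup>\<alpha> + 1) / (e\<^sup>\<alpha> - 1)\<close> and \<open>y > \<epsilon> c\<close>. The densities of all differences \<open>P0 - P1\<close> with
  \<open>\<theta> P0 - \<theta> P1 > \<omega>\<^sub>T\<^sub>V(y)\<close> form a convex subset of \<open>L\<^sup>1\<close>, since \<open>\<theta>\<close> is linear, and all of them have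
  norm at least \<open>2 y\<close>. By Hahn-Banach some \<open>l\<close> in the unit ball of \<open>L\<^sup>\<infinity>\<close> satisfies
  \<open>\<integral> l dP0 - \<integral> l dP1 \<ge> 2 y\<close> for all such pairs. On the other hand, total variation is dominated by
  the Hellinger distance, so outputs of the binary channel for \<open>l\<close> at Hellinger distance at most
  \<open>\<epsilon>\<close> force \<open>\<bar>\<integral> l dP0 - \<integral> l dP1\<bar> \<le> 2 c \<epsilon> < 2 y\<close>. Hence \<open>\<omega>\<^sub>H(\<epsilon>) \<le> \<omega>\<^sub>T\<^sub>V(y)\<close> for this channel.\<close>

section \<open>Hahn-Banach separation\<close>

text \<open>Homogeneity is asked as an inequality for \<open>c > 0\<close> only, a form that passes
  easily to infima; on a subspace, equality for \<open>c \<ge> 0\<close> follows. The carrier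
  \<open>V\<close> is explicit because the L1 norm will be sublinear on integrable functions only: a
  nonintegrable function has Bochner integral 0 by default.\<close>

definition sublinear_on :: "'b::real_vector set \<Rightarrow> ('b \<Rightarrow> real) \<Rightarrow> bool" where
  "sublinear_on V p \<longleftrightarrow>
     (\<forall>x\<in>V. \<forall>y\<in>V. p (x + y) \<le> p x + p y) \<and> (\<forall>x\<in>V. \<forall>c>0. p (c *\<^sub>R x) \<le> c * p x)"

lemma sublinear_onD:
  assumes "sublinear_on V p"
  shows "x \<in> V \<Longrightarrow> y \<in> V \<Longrightarrow> p (x + y) \<le> p x + p y"
    and "x \<in> V \<Longrightarrow> 0 < c \<Longrightarrow> p (c *\<^sub>R x) \<le> c * p x"
  using assms by (auto simp: sublinear_on_def)

lemma sublinear_on_scaleR: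
  assumes V: "subspace V" and p: "sublinear_on V p" and x: "x \<in> V" and c: "0 \<le> c"
  shows "p (c *\<^sub>R x) = c * p x"
proof (cases "c = 0")
  case True
  \<comment> \<open>The first inequality gives \<open>0 \<le> p 0\<close>, the second
    \<open>p 0 \<le> 0\<close>.\<close>
  have "p 0 \<le> 2 * p 0" "p 0 \<le> (1/2) * p 0"
    using sublinear_onD(2)[OF p subspace_0[OF V], of 2]
      sublinear_onD(2)[OF p subspace_0[OF V], of "1/2"] by auto
  then show ?thesis using True by simp
next
  case False
  with c have c: "0 < c" by simp
  have "p x \<le> inverse c * p (c *\<^sub>R x)"
    using sublinear_onD(2)[OF p subspace_scale[OF V x, of c], of "inverse c"] c by simp
  then have "c * p x \<le> p (c *\<^sub>R x)"
    using c by (simp add: field_simps)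
  then show ?thesis using sublinear_onD(2)[OF p x c] by simp
qed

lemma sublinear_on_minus:
  assumes V: "subspace V" and p: "sublinear_on V p" and x: "x \<in> V"
  shows "- p (- x) \<le> p x"
  using sublinear_onD(1)[OF p x subspace_neg[OF V x]] sublinear_on_scaleR[OF V p x, of 0] by simp

text \<open>The witness \<open>c\<close> may depend on both \<open>a\<close> and \<open>b\<close>.
  This flexibility is used twice: it will come from a convex combination of two points of
  \<open>K\<close>, and from the smaller of two members of a chain.\<close>

lemma le_cInf_add:
  fixes X Y Z :: "real set"
  assumes "X \<noteq> {}" "Y \<noteq> {}" "bdd_below Z" "\<And>a b. a \<in> X \<Longrightarrow> b \<in> Y \<Longrightarrow> \<exists>c\<in>Z. c \<le> a + b"
  shows "Inf Z \<le> Inf X + Inf Y"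
proof -
  have *: "Inf Z \<le> a + b" if "a \<in> X" "b \<in> Y" for a b
    using assms(3) assms(4)[OF that] by (meson cInf_lower2)
  have "Inf Z - b \<le> Inf X" if "b \<in> Y" for b
    using *[OF _ that] by (intro cInf_greatest assms) (simp add: diff_le_eq)
  then have "Inf Z - Inf X \<le> Inf Y"
    by (intro cInf_greatest assms) (force simp: algebra_simps)
  then show ?thesis by simp
qed

lemma cInf_le_mult:
  fixes X Y :: "real set"
  assumes "X \<noteq> {}" "bdd_below Y" "0 < c" "\<And>a. a \<in> X \<Longrightarrow> \<exists>b\<in>Y. b \<le> c * a"
  shows "Inf Y \<le> c * Inf X"
proof -
  have "Inf Y / c \<le> Inf X"
  proof (intro cInf_greatest assms)
    fix a assume "a \<in> X"
    then have "Inf Y \<le> c * a" using assms(2,4) by (meson cInf_lower2)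
    then show "Inf Y / c \<le> a" using assms(3) by (simp add: field_simps)
  qed
  then show ?thesis using assms(3) by (simp add: field_simps)
qed

text \<open>The witness is \<open>q x = Inf {p (x + t k) - t d | t \<ge> 0, k \<in> K}\<close>.\<close>

lemma sublinear_on_improve:
  fixes p :: "'b::real_vector \<Rightarrow> real"
  assumes V: "subspace V" and p: "sublinear_on V p"
    and K: "K \<subseteq> V" "convex K" "K \<noteq> {}" and d: "\<And>k. k \<in> K \<Longrightarrow> d \<le> p k"
  shows "\<exists>q. sublinear_on V q \<and> (\<forall>x\<in>V. q x \<le> p x) \<and> (\<forall>k\<in>K. q (- k) \<le> - d)"
proof -
  define S where "S x = {p (x + t *\<^sub>R k) - t * d | t k. 0 \<le> t \<and> k \<in> K}" for x
  define q where "q x = Inf (S x)" for x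
  have S_self: "p x \<in> S x" for x
  proof -
    obtain k where "k \<in> K" using K(3) by auto
    then show ?thesis unfolding S_def by (intro CollectI exI[of _ 0] exI[of _ k]) simp
  qed
  then have S_ne: "S x \<noteq> {}" for x by blast
  \<comment> \<open>Subtracting \<open>t * d\<close> cannot make the infimum diverge:
    \<open>t * d\<close> is at most \<open>p (t *\<^sub>R k)\<close>, and subadditivity bounds this
    by \<open>p (x + t *\<^sub>R k) + p (- x)\<close>.\<close>
  have S_lower: "- p (- x) \<le> s" if x: "x \<in> V" and s: "s \<in> S x" for x s
  proof -
    obtain t k where tk: "0 \<le> t" "k \<in> K" and s: "s = p (x + t *\<^sub>R k) - t * d"
      using s by (auto simp: S_def)
    have k: "t *\<^sub>R k \<in> V" using tk K V by (auto intro: subspace_scale)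
    have "t * d \<le> t * p k" using tk d by (simp add: mult_left_mono)
    also have "\<dots> = p (t *\<^sub>R k)" using sublinear_on_scaleR[OF V p] tk K by auto
    also have "\<dots> = p ((x + t *\<^sub>R k) + - x)" by simp
    also have "\<dots> \<le> p (x + t *\<^sub>R k) + p (- x)"
      using x k V by (intro sublinear_onD[OF p]) (auto intro: subspace_add subspace_neg)
    finally show ?thesis by (simp add: s)
  qed
  then have S_bdd: "bdd_below (S x)" if "x \<in> V" for x
    using that by (auto simp: bdd_below_def)
  have "q (x + y) \<le> q x + q y" if "x \<in> V" "y \<in> V" for x y
    unfolding q_def
  proof (intro le_cInf_add S_ne S_bdd subspace_add[OF V] that)
    fix a b assume "a \<in> S x" "b \<in> S y"
    then obtain t k u m where t: "0 \<le> t" "k \<in> K" "a = p (x + t *\<^sub>R k) - t * d"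
      and u: "0 \<le> u" "m \<in> K" "b = p (y + u *\<^sub>R m) - u * d"
      by (auto simp: S_def)
    \<comment> \<open>Convexity of \<open>K\<close> merges the two parameters into the mean of
      \<open>k\<close> and \<open>m\<close> with weights proportional to \<open>t\<close> and
      \<open>u\<close>; if both weights vanish, any point of \<open>K\<close> will do.\<close>
    obtain n where n: "n \<in> K" "(t + u) *\<^sub>R n = t *\<^sub>R k + u *\<^sub>R m"
    proof (cases "t + u = 0")
      case True
      then have "t = 0" "u = 0" using t u by auto
      then show ?thesis using that[of k] t by simp
    next
      case False
      then have "(t / (t + u)) *\<^sub>R k + (u / (t + u)) *\<^sub>R m \<in> K"
        using t u by (intro convexD K) (auto simp flip: add_divide_distrib)
      then show ?thesis using False by (intro that) (auto simp: scaleR_add_right)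
    qed
    have "p (x + y + (t + u) *\<^sub>R n) = p ((x + t *\<^sub>R k) + (y + u *\<^sub>R m))"
      unfolding n by (simp add: algebra_simps)
    also have "\<dots> \<le> p (x + t *\<^sub>R k) + p (y + u *\<^sub>R m)"
      using that t u K V by (intro sublinear_onD[OF p]) (auto intro!: subspace_add subspace_scale)
    finally show "\<exists>c\<in>S (x + y). c \<le> a + b"
      using t u n(1)
      by (intro bexI[of _ "p (x + y + (t + u) *\<^sub>R n) - (t + u) * d"])
        (auto simp: S_def algebra_simps intro!: exI[of _ "t + u"] exI[of _ n])
  qed
  moreover have "q (c *\<^sub>R x) \<le> c * q x" if "x \<in> V" "0 < c" for x c
    unfolding q_def
  proof (intro cInf_le_mult S_ne S_bdd subspace_scale[OF V] that)
    fix a assume "a \<in> S x"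
    then obtain t k where t: "0 \<le> t" "k \<in> K" "a = p (x + t *\<^sub>R k) - t * d"
      by (auto simp: S_def)
    have "p (c *\<^sub>R (x + t *\<^sub>R k)) \<le> c * p (x + t *\<^sub>R k)"
      using that t K V by (intro sublinear_onD[OF p]) (auto intro!: subspace_add subspace_scale)
    moreover have "p (c *\<^sub>R x + (c * t) *\<^sub>R k) - c * t * d \<in> S (c *\<^sub>R x)"
      unfolding S_def using t that by (intro CollectI exI[of _ "c * t"] exI[of _ k]) auto
    ultimately show "\<exists>b\<in>S (c *\<^sub>R x). b \<le> c * a"
      unfolding t by (intro bexI[rotated]) (auto simp: algebra_simps)
  qed
  moreover have "q x \<le> p x" if "x \<in> V" for x
    unfolding q_def using that by (intro cInf_lower S_bdd S_self)
  moreover have "q (- k) \<le> - d" if k: "k \<in> K" for k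
  proof -
    have "p 0 = 0" using sublinear_on_scaleR[OF V p subspace_0[OF V], of 0] by simp
    \<comment> \<open>With \<open>t = 1\<close> the point \<open>k\<close> cancels the argument
      \<open>- k\<close>, which leaves \<open>p 0 - d\<close>.\<close>
    then have "- d \<in> S (- k)" using k by (auto simp: S_def intro!: exI[of _ 1] exI[of _ k])
    then show ?thesis unfolding q_def using k K V by (intro cInf_lower S_bdd) (auto intro: subspace_neg)
  qed
  ultimately show ?thesis unfolding sublinear_on_def by (intro exI[of _ q]) blast
qed

text \<open>A minimal sublinear functional is odd, because \<open>sublinear_on_improve\<close> applied to a singleton
  cannot decrease it any further, and an odd sublinear functional is linear.\<close>

lemma Hahn_Banach_dominated:
  fixes p :: "'b::real_vector \<Rightarrow> real"
  assumes V: "subspace V" and p: "sublinear_on V p"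
  shows "\<exists>F. (\<forall>x\<in>V. F x \<le> p x) \<and> (\<forall>x\<in>V. \<forall>y\<in>V. F (x + y) = F x + F y) \<and>
    (\<forall>x\<in>V. \<forall>c. F (c *\<^sub>R x) = c * F x)"
proof -
  define A where "A = {q. sublinear_on V q \<and> (\<forall>x\<in>V. q x \<le> p x) \<and> (\<forall>x. x \<notin> V \<longrightarrow> q x = 0)}"
  \<comment> \<open>Fixing the value 0 outside \<open>V\<close> makes the pointwise order on the
    whole type an order on functionals on \<open>V\<close>, so that minimality gives equality of
    functions.\<close>
  define restr where "restr q x = (if x \<in> V then q x else 0)" for q :: "'b \<Rightarrow> real" and x
  have restr: "restr q \<in> A" if "sublinear_on V q" "\<forall>x\<in>V. q x \<le> p x" for q
    using that V by (auto simp: A_def restr_def sublinear_on_def subspace_add subspace_scale)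
  have "\<exists>F\<in>A. \<forall>q\<in>A. q \<le> F \<longrightarrow> q = F"
  \<comment> \<open>The order is reversed, so Zorn's lemma yields a minimal element; the infimum of
    a chain is its bound.\<close>
  proof (rule predicate_Zorn[where P = "\<lambda>a b. b \<le> a"])
    show "partial_order_on A (relation_of (\<lambda>a b. b \<le> a) A)"
      by (auto simp: partial_order_on_def preorder_on_def refl_on_def trans_def antisym_def
          relation_of_def)
  next
    fix C assume "C \<in> Chains (relation_of (\<lambda>a b. b \<le> a) A)"
    then have CA: "C \<subseteq> A" and chain: "\<And>f g. f \<in> C \<Longrightarrow> g \<in> C \<Longrightarrow> f \<le> g \<or> g \<le> f"
      by (auto simp: Chains_def relation_of_def)
    show "\<exists>u\<in>A. \<forall>a\<in>C. u \<le> a"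
    proof (cases "C = {}")
      case True
      then show ?thesis using restr[OF p] by auto
    next
      case False
      define u where "u x = Inf ((\<lambda>q. q x) ` C)" for x
      \<comment> \<open>All members of the chain share one lower bound at \<open>x\<close>, since
        \<open>q x \<ge> - q (- x) \<ge> - p (- x)\<close>.\<close>
      have bdd: "bdd_below ((\<lambda>q. q x) ` C)" if "x \<in> V" for x
      proof (rule bdd_belowI2)
        fix q assume "q \<in> C"
        then have "q \<in> A" using CA by auto
        then show "- p (- x) \<le> q x"
          using sublinear_on_minus[OF V _ that, of q] subspace_neg[OF V that] by (force simp: A_def)
      qed
      have sub: "sublinear_on V q" if "q \<in> C" for q using CA that by (auto simp: A_def)
      have "u (x + y) \<le> u x + u y" if xy: "x \<in> V" "y \<in> V" for x y
        unfolding u_def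
      proof (intro le_cInf_add bdd subspace_add[OF V] xy)
        fix a b assume "a \<in> (\<lambda>q. q x) ` C" "b \<in> (\<lambda>q. q y) ` C"
        then obtain f g where fg: "f \<in> C" "g \<in> C" "a = f x" "b = g y" by auto
        then obtain h where h: "h \<in> C" "h \<le> f" "h \<le> g" using chain by blast
        have "h (x + y) \<le> h x + h y" using sublinear_onD(1)[OF sub[OF h(1)] xy] .
        also have "\<dots> \<le> a + b" using h fg by (auto simp: le_fun_def intro: add_mono)
        finally show "\<exists>c\<in>(\<lambda>q. q (x + y)) ` C. c \<le> a + b" using h by auto
      qed (use False in auto)
      moreover have "u (c *\<^sub>R x) \<le> c * u x" if "x \<in> V" "0 < c" for x c
        unfolding u_def using False that sublinear_onD(2)[OF sub]
        by (intro cInf_le_mult bdd subspace_scale[OF V]) auto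
      moreover have le: "u x \<le> q x" if "x \<in> V" "q \<in> C" for x q
        unfolding u_def using that by (intro cInf_lower bdd) auto
      moreover have "u x \<le> p x" if "x \<in> V" for x
      proof -
        obtain q where "q \<in> C" using False by auto
        then show ?thesis using le[OF that, of q] CA that by (fastforce simp: A_def)
      qed
      ultimately have "restr u \<in> A" by (intro restr) (auto simp: sublinear_on_def)
      moreover have "restr u \<le> q" if "q \<in> C" for q
        using that CA le by (auto simp: le_fun_def restr_def A_def)
      ultimately show ?thesis by auto
    qed
  qed
  then obtain F where "F \<in> A" and min: "\<And>q. q \<in> A \<Longrightarrow> q \<le> F \<Longrightarrow> q = F" by auto
  then have F: "sublinear_on V F" "\<And>x. x \<in> V \<Longrightarrow> F x \<le> p x" "\<And>x. x \<notin> V \<Longrightarrow> F x = 0"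
    by (auto simp: A_def)
  have odd: "F (- x) = - F x" if x: "x \<in> V" for x
  proof -
    obtain q where q: "sublinear_on V q" "\<forall>x\<in>V. q x \<le> F x" "q (- x) \<le> - F x"
      using sublinear_on_improve[OF V F(1), of "{x}" "F x"] x by auto
    have "restr q = F"
      using q F by (intro min restr) (auto simp: le_fun_def restr_def intro: order_trans)
    then have "q (- x) = F (- x)" using subspace_neg[OF V x] by (metis restr_def)
    then show ?thesis
      using q(3) sublinear_on_minus[OF V F(1) subspace_neg[OF V x]]
        sublinear_on_minus[OF V F(1) x] by simp
  qed
  have "F (x + y) = F x + F y" if xy: "x \<in> V" "y \<in> V" for x y
  proof -
    have "F ((x + y) + - y) \<le> F (x + y) + F (- y)"
      using xy V by (intro sublinear_onD[OF F(1)]) (auto intro: subspace_add subspace_neg)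
    then show ?thesis using odd[OF xy(2)] sublinear_onD(1)[OF F(1) xy] by simp
  qed
  moreover have "F (c *\<^sub>R x) = c * F x" if x: "x \<in> V" for c x
  proof (cases "0 \<le> c")
    case True
    then show ?thesis using sublinear_on_scaleR[OF V F(1) x] by simp
  next
    case False
    then have "F (c *\<^sub>R x) = - F ((- c) *\<^sub>R x)"
      using odd[OF subspace_scale[OF V x, of "- c"]] by simp
    then show ?thesis using False sublinear_on_scaleR[OF V F(1) x, of "- c"] by simp
  qed
  ultimately show ?thesis using F(2) by blast
qed

text \<open>The constraint from \<open>K\<close> is first absorbed into a smaller sublinear
  \<open>q\<close> with \<open>q (- k) \<le> - d\<close>. Every linear \<open>F\<close> below
  \<open>q\<close> then satisfies \<open>F k = - F (- k) \<ge> d\<close>.\<close>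

corollary sublinear_separation:
  fixes p :: "'b::real_vector \<Rightarrow> real"
  assumes V: "subspace V" and p: "sublinear_on V p"
    and K: "K \<subseteq> V" "convex K" "K \<noteq> {}" and d: "\<And>k. k \<in> K \<Longrightarrow> d \<le> p k"
  shows "\<exists>F. (\<forall>x\<in>V. F x \<le> p x) \<and> (\<forall>x\<in>V. \<forall>y\<in>V. F (x + y) = F x + F y) \<and>
    (\<forall>x\<in>V. \<forall>c. F (c *\<^sub>R x) = c * F x) \<and> (\<forall>k\<in>K. d \<le> F k)"
proof -
  obtain q where q: "sublinear_on V q" "\<forall>x\<in>V. q x \<le> p x" "\<forall>k\<in>K. q (- k) \<le> - d"
    using sublinear_on_improve[OF assms] by auto
  obtain F where F: "\<forall>x\<in>V. F x \<le> q x" "\<forall>x\<in>V. \<forall>y\<in>V. F (x + y) = F x + F y"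
    "\<forall>x\<in>V. \<forall>c. F (c *\<^sub>R x) = c * F x"
    using Hahn_Banach_dominated[OF V q(1)] by auto
  have "d \<le> F k" if k: "k \<in> K" for k
  proof -
    have kV: "k \<in> V" using k K by auto
    have "F ((- 1) *\<^sub>R k) = - F k" using F(3) kV by (metis mult_minus1)
    then have "- F k \<le> q (- k)" using F(1) subspace_neg[OF V kV] by auto
    then show ?thesis using q(3) k by fastforce
  qed
  moreover have "F x \<le> p x" if "x \<in> V" for x
    using F(1) q(2) that by (blast intro: order_trans)
  ultimately show ?thesis using F(2,3) by (intro exI[of _ F]) blast
qed

text \<open>Together with pointwise addition this makes the real functions a real vector space, so
  that \<open>subspace\<close> and \<open>convex\<close> apply to sets of integrable
  functions.\<close>

instantiation "fun" :: (type, real_vector) real_vector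
begin

definition scaleR_fun_def: "scaleR c f = (\<lambda>x. c *\<^sub>R f x)"

instance
  by standard (auto simp: scaleR_fun_def fun_eq_iff algebra_simps)

end

section \<open>Bounded functionals on the space of integrable functions\<close>

lemma integrable_of_finite_density:
  fixes D :: "'a \<Rightarrow> real"
  assumes "finite_measure (density M (\<lambda>x. ennreal (D x)))" "D \<in> borel_measurable M"
    "\<And>x. x \<in> space M \<Longrightarrow> 0 \<le> D x"
  shows "integrable M D"
proof -
  interpret finite_measure "density M (\<lambda>x. ennreal (D x))" by fact
  have "(\<integral>\<^sup>+x. ennreal (D x) \<partial>M) = emeasure (density M (\<lambda>x. ennreal (D x))) (space M)"
    using assms(2) by (simp add: emeasure_density cong: nn_integral_cong)
  also have "\<dots> < \<infinity>"
    using emeasure_finite[of "space M"] by (metis infinity_ennreal_def top.not_eq_extremum)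
  finally show ?thesis using assms(2,3) by (intro integrableI_nonneg) auto
qed

lemma (in sigma_finite_measure) finite_measure_density_exists:
  assumes N: "finite_measure N" and ac: "absolutely_continuous M N" and s: "sets N = sets M"
  obtains D :: "'a \<Rightarrow> real" where "integrable M D" "\<And>x. 0 \<le> D x"
    "N = density M (\<lambda>x. ennreal (D x))"
proof -
  obtain D where D: "D \<in> borel_measurable M" "AE x in M. RN_deriv M N x = ennreal (D x)"
    "\<And>x. 0 \<le> D x"
    using real_RN_deriv[OF assms] by metis
  have "N = density M (\<lambda>x. ennreal (D x))"
    using D density_RN_deriv[OF ac s] density_cong[of "RN_deriv M N" M "\<lambda>x. ennreal (D x)"] by simp
  then show thesis using D N integrable_of_finite_density[of M D] that by simp
qed

lemma measure_density_real:
  fixes D :: "'a \<Rightarrow> real"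
  assumes "D \<in> borel_measurable M" "\<And>x. x \<in> space M \<Longrightarrow> 0 \<le> D x" "A \<in> sets M"
  shows "measure (density M (\<lambda>x. ennreal (D x))) A = (LINT x|M. indicator A x * D x)"
proof -
  have "measure (density M (\<lambda>x. ennreal (D x))) A
      = (LINT x|density M (\<lambda>x. ennreal (D x)). indicator A x)"
    using assms(3) sets.sets_into_space[OF assms(3)] by (simp add: Int_absorb2)
  also have "\<dots> = (LINT x|M. D x * indicator A x)"
    using assms by (subst integral_density) auto
  finally show ?thesis by (simp add: mult.commute)
qed

text \<open>The bound makes \<open>A \<mapsto> F 1\<^sub>A + M A\<close> a finite measure with values between \<open>0\<close> and \<open>2 M A\<close>;
  subtracting \<open>1\<close> from its Radon-Nikodym derivative gives the representing function.\<close>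

lemma (in finite_measure) L1_functional_representation:
  fixes F :: "('a \<Rightarrow> real) \<Rightarrow> real"
  assumes add: "\<And>f g. integrable M f \<Longrightarrow> integrable M g \<Longrightarrow> F (\<lambda>x. f x + g x) = F f + F g"
    and scale: "\<And>f c. integrable M f \<Longrightarrow> F (\<lambda>x. c * f x) = c * F f"
    and bound: "\<And>f. integrable M f \<Longrightarrow> F f \<le> (LINT x|M. \<bar>f x\<bar>)"
  shows "\<exists>l\<in>borel_measurable M. (\<forall>x. \<bar>l x\<bar> \<le> 1) \<and>
    (\<forall>f. integrable M f \<longrightarrow> F f = (LINT x|M. l x * f x))"
proof -
  have abs_F: "\<bar>F f\<bar> \<le> (LINT x|M. \<bar>f x\<bar>)" if "integrable M f" for f
    using bound[OF that] bound[of "\<lambda>x. - 1 * f x"] scale[OF that, of "- 1"] that by simp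
  define m where "m A = F (indicator A) + measure M A" for A
  have ind: "integrable M (indicator A :: _ \<Rightarrow> real)" if "A \<in> sets M" for A
    using that by (simp add: emeasure_finite less_top[symmetric])
  have F_ind: "\<bar>F (indicator A)\<bar> \<le> measure M A" if A: "A \<in> sets M" for A
    using abs_F[OF ind[OF A]] sets.sets_into_space[OF A] by (simp add: Int_absorb2)
  have m: "0 \<le> m A" "m A \<le> 2 * measure M A" if "A \<in> sets M" for A
    using F_ind[OF that] by (auto simp: m_def)
  define \<Lambda> where "\<Lambda> = measure_of (space M) (sets M) (\<lambda>A. ennreal (m A))"
  have [simp]: "space \<Lambda> = space M" "sets \<Lambda> = sets M" by (simp_all add: \<Lambda>_def)
  have m0: "m {} = 0" using m[of "{}"] by simp
  have m_add: "m (A \<union> B) = m A + m B" if "A \<in> sets M" "B \<in> sets M" "A \<inter> B = {}" for A B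
  proof -
    have "(indicator (A \<union> B) :: 'a \<Rightarrow> real) = (\<lambda>x. indicator A x + indicator B x)"
      using that(3) by (auto simp: fun_eq_iff indicator_def)
    then show ?thesis
      using that add[OF ind ind, of A B] finite_measure_Union[of A B] by (simp add: m_def)
  qed
  have ca: "countably_additive (sets M) (\<lambda>A. ennreal (m A))"
  \<comment> \<open>For a finite additive set function, countable additivity reduces to continuity
    at the empty set, which \<open>m\<close> inherits from \<open>M\<close> through
    \<open>m A \<le> 2 * measure M A\<close>.\<close>
  proof (rule sets.empty_continuous_imp_countably_additive)
    show "positive (sets M) (\<lambda>A. ennreal (m A))" by (simp add: positive_def m0)
    show "additive (sets M) (\<lambda>A. ennreal (m A))"
      by (auto simp: additive_def m_add m ennreal_plus)
    fix A :: "nat \<Rightarrow> 'a set"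
    assume A: "range A \<subseteq> sets M" "decseq A" "(\<Inter>i. A i) = {}"
    have "(\<lambda>i. 2 * measure M (A i)) \<longlonglongrightarrow> 2 * 0"
      using finite_Lim_measure_decseq[OF A(1,2)] A(3) by (intro tendsto_mult tendsto_const) simp
    then have "(\<lambda>i. m (A i)) \<longlonglongrightarrow> 0"
    proof (rule Lim_null_comparison[rotated, OF tendsto_eq_rhs])
      show "\<forall>\<^sub>F i in sequentially. norm (m (A i)) \<le> 2 * measure M (A i)"
        using A(1) m by auto
    qed simp
    from tendsto_ennrealI[OF this] show "(\<lambda>i. ennreal (m (A i))) \<longlonglongrightarrow> 0" by simp
  qed simp
  have \<Lambda>: "emeasure \<Lambda> A = ennreal (m A)" if "A \<in> sets M" for A
    unfolding \<Lambda>_def using that ca m0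
    by (intro emeasure_measure_of_sigma sets.sigma_algebra_axioms) (auto simp: positive_def)
  have "finite_measure \<Lambda>" by (rule finite_measureI) (simp add: \<Lambda>)
  moreover have "absolutely_continuous M \<Lambda>"
  proof -
    have "m A = 0" if "A \<in> sets M" "emeasure M A = 0" for A
      using m[OF that(1)] that(2) by (simp add: measure_def)
    then show ?thesis by (auto simp: absolutely_continuous_def null_sets_def \<Lambda>)
  qed
  ultimately obtain D where D: "integrable M D" "\<And>x. 0 \<le> D x"
    and \<Lambda>D: "\<Lambda> = density M (\<lambda>x. ennreal (D x))"
    using finite_measure_density_exists[of \<Lambda>] by auto
  have D_int: "(LINT x|M. indicator A x * D x) = m A" if "A \<in> sets M" for A
    using measure_density_real[OF borel_measurable_integrable[OF D(1)] D(2) that] \<Lambda>[OF that] m(1)[OF that]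
    by (simp add: \<Lambda>D[symmetric] measure_def)
  \<comment> \<open>The mean of \<open>D\<close> over a set \<open>A\<close> of positive measure is
    \<open>m A / measure M A\<close>; if all means lie in a closed set, so does \<open>D\<close>
    almost everywhere.\<close>
  have "AE x in M. D x \<in> {0..2}"
  proof (rule averaging_theorem)
    fix A assume A: "A \<in> sets M" "0 < measure M A"
    have "m A / measure M A \<in> {0..2}" using m[OF A(1)] A(2) by (simp add: field_simps)
    then show "(1 / measure M A) *\<^sub>R set_lebesgue_integral M A D \<in> {0..2}"
      using D_int[OF A(1)] by (simp add: set_lebesgue_integral_def)
  qed (use D in auto)
  \<comment> \<open>Truncation changes \<open>D - 1\<close> on a null set only and makes the bound
    by 1 hold everywhere. This matters because \<open>sup_norm\<close> is a pointwise
    supremum.\<close>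
  define l where "l x = max (- 1) (min 1 (D x - 1))" for x
  have [measurable]: "D \<in> borel_measurable M" using D by auto
  have l[measurable]: "l \<in> borel_measurable M" unfolding l_def by measurable
  have l_le: "\<bar>l x\<bar> \<le> 1" for x by (auto simp: l_def)
  have l_int: "integrable M (\<lambda>x. l x * f x)" if "integrable M f" for f
  proof (rule Bochner_Integration.integrable_bound[OF that])
    have [measurable]: "f \<in> borel_measurable M" using that by auto
    show "(\<lambda>x. l x * f x) \<in> borel_measurable M" by measurable
    show "AE x in M. norm (l x * f x) \<le> norm (f x)"
      using l_le by (auto simp: abs_mult intro!: mult_left_le_one_le)
  qed
  have "F f = (LINT x|M. l x * f x)" if "integrable M f" for f
    using that
  proof (induct rule: integrable_induct)
    case (base A c)
    have [measurable]: "A \<in> sets M" by fact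
    have "(LINT x|M. l x * indicator A x) = (LINT x|M. indicator A x * D x - indicator A x)"
      using \<open>AE x in M. D x \<in> {0..2}\<close>
      by (intro integral_cong_AE; measurable; eventually_elim) (auto simp: l_def algebra_simps)
    also have "\<dots> = m A - measure M A"
    proof (subst Bochner_Integration.integral_diff)
      show "integrable M (\<lambda>x. indicator A x * D x)"
        using integrable_mult_indicator[OF base(1) D(1)] by simp
    qed (use base ind[OF base(1)] D_int sets.sets_into_space[OF base(1)] in
        \<open>auto simp: Int_absorb2\<close>)
    also have "\<dots> = F (indicator A)" by (simp add: m_def)
    finally have "(LINT x|M. c * (l x * indicator A x)) = F (\<lambda>x. c * indicator A x)"
      using scale[OF ind[OF base(1)]] by simp
    then show ?case by (simp add: mult_ac)
  next
    case (add f g)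
    then show ?case
      using assms(1) l_int by (simp add: distrib_left)
  next
    case (lim f s)
    have [measurable]: "f \<in> borel_measurable M" "s i \<in> borel_measurable M" for i
      using lim by auto
    have "(\<lambda>i. LINT x|M. \<bar>f x - s i x\<bar>) \<longlonglongrightarrow> (LINT x|M. 0)"
    \<comment> \<open>The approximants satisfy
      \<open>\<bar>s i x\<bar> \<le> 2 * \<bar>f x\<bar>\<close>, hence the factor 3.\<close>
    proof (rule integral_dominated_convergence[where w = "\<lambda>x. 3 * \<bar>f x\<bar>"])
      show "AE x in M. (\<lambda>i. \<bar>f x - s i x\<bar>) \<longlonglongrightarrow> 0"
      proof (rule AE_I2)
        fix x assume "x \<in> space M"
        from tendsto_diff[OF tendsto_const[of "f x"] lim(3)[OF this]]
        show "(\<lambda>i. \<bar>f x - s i x\<bar>) \<longlonglongrightarrow> 0" by (intro tendsto_rabs_zero) simp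
      qed
      show "AE x in M. norm \<bar>f x - s i x\<bar> \<le> 3 * \<bar>f x\<bar>" for i
      proof (rule AE_I2)
        fix x assume "x \<in> space M"
        from lim(4)[OF this, of i] show "norm \<bar>f x - s i x\<bar> \<le> 3 * \<bar>f x\<bar>" by simp
      qed
    qed (use lim(5) in auto)
    then have L1: "(\<lambda>i. LINT x|M. \<bar>f x - s i x\<bar>) \<longlonglongrightarrow> 0" by simp
    have "(\<lambda>i. F f - F (s i)) \<longlonglongrightarrow> 0"
    proof (rule Lim_null_comparison[OF _ L1])
      have "norm (F f - F (s i)) \<le> (LINT x|M. \<bar>f x - s i x\<bar>)" for i
        using abs_F[of "\<lambda>x. f x + - 1 * s i x"] lim(1,5)
          assms(1)[of f "\<lambda>x. - 1 * s i x"] scale[of "s i" "- 1"] by simp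
      then show "\<forall>\<^sub>F i in sequentially. norm (F f - F (s i)) \<le> (LINT x|M. \<bar>f x - s i x\<bar>)"
        by simp
    qed
    moreover have "(\<lambda>i. (LINT x|M. l x * f x) - F (s i)) \<longlonglongrightarrow> 0"
    proof (rule Lim_null_comparison[OF _ L1])
      have "norm ((LINT x|M. l x * f x) - F (s i)) \<le> (LINT x|M. \<bar>f x - s i x\<bar>)" for i
      proof -
        have "(LINT x|M. l x * f x) - F (s i) = (LINT x|M. l x * f x - l x * s i x)"
          using lim(1,2,5) l_int by simp
        also have "norm \<dots> \<le> (LINT x|M. norm (l x * f x - l x * s i x))"
          by (rule integral_norm_bound)
        also have "\<dots> \<le> (LINT x|M. \<bar>f x - s i x\<bar>)"
        proof (rule integral_mono)
          show "integrable M (\<lambda>x. norm (l x * f x - l x * s i x))"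
            "integrable M (\<lambda>x. \<bar>f x - s i x\<bar>)"
            using lim(1,5) l_int by auto
          show "norm (l x * f x - l x * s i x) \<le> \<bar>f x - s i x\<bar>" for x
            using l_le[of x]
            by (auto simp: abs_mult simp flip: right_diff_distrib intro!: mult_left_le_one_le)
        qed
        finally show ?thesis .
      qed
      then show "\<forall>\<^sub>F i in sequentially.
          norm ((LINT x|M. l x * f x) - F (s i)) \<le> (LINT x|M. \<bar>f x - s i x\<bar>)"
        by simp
    qed
    \<comment> \<open>The terms \<open>F (s i)\<close> cancel, so this sequence is constant; its
      limit 0 is the claimed equality.\<close>
    ultimately have "(\<lambda>i. (F f - F (s i)) - ((LINT x|M. l x * f x) - F (s i))) \<longlonglongrightarrow> 0 - 0"
      by (rule tendsto_diff)
    then show ?case by (simp add: LIMSEQ_const_iff)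
  qed
  then show ?thesis using l l_le by blast
qed

text \<open>With the L1 norm as dominating functional, the separating functional has norm at most 1
  and is therefore given by some \<open>l\<close> in the unit ball. The set \<open>K\<close> may be
  empty, and then \<open>l = 0\<close> serves.\<close>

lemma (in finite_measure) L1_separation:
  fixes K :: "('a \<Rightarrow> real) set"
  assumes K: "\<And>f. f \<in> K \<Longrightarrow> integrable M f" "convex K"
    and d: "\<And>f. f \<in> K \<Longrightarrow> d \<le> (LINT x|M. \<bar>f x\<bar>)"
  shows "\<exists>l\<in>borel_measurable M. (\<forall>x. \<bar>l x\<bar> \<le> 1) \<and> (\<forall>f\<in>K. d \<le> (LINT x|M. l x * f x))"
proof (cases "K = {}")
  case True
  then show ?thesis by (intro bexI[of _ "\<lambda>_. 0"]) auto
next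
  case False
  define V where "V = {f. integrable M (f :: 'a \<Rightarrow> real)}"
  have V: "subspace V"
    by (auto simp: subspace_def V_def zero_fun_def plus_fun_def scaleR_fun_def)
  have "sublinear_on V (\<lambda>f. LINT x|M. \<bar>f x\<bar>)"
    by (auto simp: sublinear_on_def V_def plus_fun_def scaleR_fun_def abs_mult
        simp flip: Bochner_Integration.integral_add intro!: integral_mono)
  moreover have "K \<subseteq> V" using K(1) by (auto simp: V_def)
  ultimately obtain F where F: "\<And>f. f \<in> V \<Longrightarrow> F f \<le> (LINT x|M. \<bar>f x\<bar>)"
    "\<And>f g. f \<in> V \<Longrightarrow> g \<in> V \<Longrightarrow> F (f + g) = F f + F g"
    "\<And>f c. f \<in> V \<Longrightarrow> F (c *\<^sub>R f) = c * F f" "\<And>f. f \<in> K \<Longrightarrow> d \<le> F f"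
    using sublinear_separation[OF V _ _ K(2) False, of "\<lambda>f. LINT x|M. \<bar>f x\<bar>" d] d by blast
  obtain l where "l \<in> borel_measurable M" "\<And>x. \<bar>l x\<bar> \<le> 1"
    "\<And>f. integrable M f \<Longrightarrow> F f = (LINT x|M. l x * f x)"
    using L1_functional_representation[of F] F
    by (auto simp: V_def plus_fun_def scaleR_fun_def)
  then show ?thesis using F(4) K(1) by (intro bexI[of _ l]) auto
qed

section \<open>Hellinger distance and the binary channel\<close>

text \<open>The function \<open>2 * indicator A x - 1\<close> takes only the values 1 and -1, and
  the subtracted term contributes nothing because \<open>f\<close> integrates to 0. This is the
  factor 1/2 between total variation and the L1 norm.\<close>

lemma abs_integral_indicator_le:
  fixes f :: "'a \<Rightarrow> real"
  assumes f: "integrable M f" "(LINT x|M. f x) = 0" and A: "A \<in> sets M"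
  shows "\<bar>LINT x|M. indicator A x * f x\<bar> \<le> (LINT x|M. \<bar>f x\<bar>) / 2"
proof -
  have i: "integrable M (\<lambda>x. indicator A x * f x)"
    using integrable_mult_indicator[OF A f(1)] by simp
  have "2 * (LINT x|M. indicator A x * f x) = (LINT x|M. 2 * (indicator A x * f x) - f x)"
    using i f by simp
  also have "\<bar>\<dots>\<bar> \<le> (LINT x|M. \<bar>2 * (indicator A x * f x) - f x\<bar>)"
    by (rule integral_abs_bound)
  also have "\<dots> = (LINT x|M. \<bar>f x\<bar>)"
    by (intro Bochner_Integration.integral_cong) (auto simp: indicator_def)
  finally show ?thesis by simp
qed

text \<open>A weighted AM-GM inequality replaces Cauchy-Schwarz. For every \<open>e\<close> above
  the Hellinger distance, \<open>\<bar>p0 - p1\<bar> \<le> h / e + e * (p0 + p1) / 2\<close> holds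
  pointwise and integrates to at most \<open>2 * e\<close>. Taking \<open>e\<close> strictly larger
  keeps the division legitimate when the distance is 0.\<close>

lemma measure_diff_le_hellinger_dist:
  assumes P: "prob_space P0" "prob_space P1" "sets P1 = sets P0" and A: "A \<in> sets P0"
  shows "\<bar>measure P0 A - measure P1 A\<bar> \<le> hellinger_dist P0 P1"
proof -
  interpret P0: prob_space P0 by fact
  interpret P1: prob_space P1 by fact
  obtain \<mu> p0 p1 where dens: "densities_wrt P0 P1 \<mu> p0 p1"
    using densities_wrt_exist[OF P] by blast
  then have [measurable]: "p0 \<in> borel_measurable \<mu>" "p1 \<in> borel_measurable \<mu>"
    and nn: "\<And>x. x \<in> space \<mu> \<Longrightarrow> 0 \<le> p0 x" "\<And>x. x \<in> space \<mu> \<Longrightarrow> 0 \<le> p1 x"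
    and eq: "P0 = density \<mu> p0" "P1 = density \<mu> p1"
    by (auto simp: densities_wrt_def)
  define h where "h x = (sqrt (p0 x) - sqrt (p1 x))\<^sup>2" for x
  have H: "hellinger_dist P0 P1 = sqrt (LINT x|\<mu>. h x)"
    using hellinger_dist_eq[OF _ _ dens] P0.finite_measure_axioms P1.finite_measure_axioms
    by (simp add: h_def)
  have int: "integrable \<mu> p0" "integrable \<mu> p1"
    using P0.finite_measure_axioms P1.finite_measure_axioms nn
    by (auto intro!: integrable_of_finite_density simp: eq)
  have meas: "measure P0 B = (LINT x|\<mu>. indicator B x * p0 x)"
    "measure P1 B = (LINT x|\<mu>. indicator B x * p1 x)" if "B \<in> sets \<mu>" for B
    unfolding eq using that nn by (simp_all add: measure_density_real)
  have one: "(LINT x|\<mu>. p0 x) = 1" "(LINT x|\<mu>. p1 x) = 1"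
    using meas[of "space \<mu>"] P0.prob_space P1.prob_space
    by (simp_all add: eq cong: Bochner_Integration.integral_cong)
  have int_h: "integrable \<mu> h"
  proof (rule Bochner_Integration.integrable_bound)
    show "integrable \<mu> (\<lambda>x. p0 x + p1 x)" using int by simp
    show "h \<in> borel_measurable \<mu>" unfolding h_def by measurable
    show "AE x in \<mu>. norm (h x) \<le> norm (p0 x + p1 x)"
    proof (rule AE_I2)
      fix x assume x: "x \<in> space \<mu>"
      then have "h x \<le> p0 x + p1 x" using nn by (simp add: h_def power2_diff)
      moreover have "0 \<le> h x" by (simp add: h_def)
      ultimately show "norm (h x) \<le> norm (p0 x + p1 x)" by simp
    qed
  qed
  define f where "f x = p0 x - p1 x" for x
  have f: "integrable \<mu> f" "(LINT x|\<mu>. f x) = 0"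
    unfolding f_def using int one by simp_all
  have [simp]: "A \<in> sets \<mu>" using A eq by simp
  have diff: "measure P0 A - measure P1 A = (LINT x|\<mu>. indicator A x * f x)"
    using int integrable_mult_indicator[of A \<mu> p0] integrable_mult_indicator[of A \<mu> p1]
    by (simp add: meas f_def right_diff_distrib)
  show ?thesis
  proof (rule dense_ge)
    fix e assume e: "hellinger_dist P0 P1 < e"
    have "0 \<le> (LINT x|\<mu>. h x)" by (simp add: h_def)
    then have "0 < e" using e unfolding H by (rule le_less_trans[OF real_sqrt_ge_zero])
    have He: "(LINT x|\<mu>. h x) \<le> e\<^sup>2"
      using e unfolding H by (intro sqrt_le_D less_imp_le)
    have "(LINT x|\<mu>. \<bar>f x\<bar>) \<le> (LINT x|\<mu>. h x / e + e * (p0 x + p1 x) / 2)"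
    proof (rule integral_mono)
      fix x assume x: "x \<in> space \<mu>"
      define a b where "a = sqrt (p0 x)" and "b = sqrt (p1 x)"
      have ab: "0 \<le> a" "0 \<le> b" "p0 x = a\<^sup>2" "p1 x = b\<^sup>2"
        using nn[OF x] by (auto simp: a_def b_def)
      have "\<bar>a - b\<bar> * (a + b) = \<bar>a\<^sup>2 - b\<^sup>2\<bar>"
        using ab by (simp add: square_diff_square_factored power2_eq_square abs_mult)
      \<comment> \<open>The pointwise bound is the nonnegativity of this square, combined with
        \<open>(a + b)\<^sup>2 \<le> 2 * (a\<^sup>2 + b\<^sup>2)\<close>.\<close>
      then have "(\<bar>a - b\<bar> - e / 2 * (a + b))\<^sup>2
          = (a - b)\<^sup>2 - e * \<bar>a\<^sup>2 - b\<^sup>2\<bar> + e\<^sup>2 / 4 * (a + b)\<^sup>2"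
        unfolding power2_diff[of "\<bar>a - b\<bar>"] by (simp add: power_mult_distrib power_divide)
      moreover have "e\<^sup>2 / 4 * (a + b)\<^sup>2 \<le> e\<^sup>2 / 4 * (2 * (a\<^sup>2 + b\<^sup>2))"
        using zero_le_power2[of "a - b"] by (intro mult_left_mono) (simp_all add: power2_sum power2_diff)
      ultimately have "e * \<bar>a\<^sup>2 - b\<^sup>2\<bar> \<le> (a - b)\<^sup>2 + e\<^sup>2 * (a\<^sup>2 + b\<^sup>2) / 2"
        using zero_le_power2[of "\<bar>a - b\<bar> - e / 2 * (a + b)"] by linarith
      then have "\<bar>a\<^sup>2 - b\<^sup>2\<bar> \<le> ((a - b)\<^sup>2 + e\<^sup>2 * (a\<^sup>2 + b\<^sup>2) / 2) / e"
        using \<open>0 < e\<close> by (simp add: pos_le_divide_eq mult.commute)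
      also have "\<dots> = (a - b)\<^sup>2 / e + e * (a\<^sup>2 + b\<^sup>2) / 2"
        using \<open>0 < e\<close> by (simp add: add_divide_distrib power2_eq_square)
      finally show "\<bar>f x\<bar> \<le> h x / e + e * (p0 x + p1 x) / 2"
        by (simp only: f_def h_def ab(3,4) real_sqrt_abs abs_of_nonneg[OF ab(1)] abs_of_nonneg[OF ab(2)])
    qed (use f int int_h in auto)
    also have "\<dots> = (LINT x|\<mu>. h x) / e + e"
      using int int_h one by simp
    also have "\<dots> \<le> 2 * e"
      using He \<open>0 < e\<close> by (simp add: field_simps power2_eq_square)
    finally show "\<bar>measure P0 A - measure P1 A\<bar> \<le> e"
      using abs_integral_indicator_le[OF f, of A] by (simp add: diff)
  qed
qed

lemma (in prob_space) integrable_Linfty: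
  assumes "l \<in> Linfty M"
  shows "integrable M l"
proof (rule integrable_const_bound[of _ "sup_norm M l"])
  show "AE x in M. norm (l x) \<le> sup_norm M l"
    using abs_le_sup_norm[OF assms] by auto
qed (use assms in \<open>simp add: Linfty_def\<close>)

lemma measure_bind_binary_channel:
  assumes l: "l \<in> Linfty M" and \<alpha>: "0 < \<alpha>" and P: "prob_space P" "sets P = sets M"
    and y: "y \<in> space M" "l y \<noteq> 0"
  shows "measure (P \<bind> binary_channel M \<alpha> l) {channel_level M \<alpha> l}
    = (1 + (LINT x|P. l x) / channel_level M \<alpha> l) / 2"
proof -
  interpret P: prob_space P by fact
  have sp: "space P = space M" using P(2) by (rule sets_eq_imp_space_eq)
  have lP: "l \<in> Linfty P"
    using l P(2) sp by (simp add: Linfty_def cong: measurable_cong_sets)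
  define z where "z = channel_level M \<alpha> l"
  have "emeasure (P \<bind> binary_channel M \<alpha> l) {z} = (\<integral>\<^sup>+x. emeasure (binary_channel M \<alpha> l x) {z} \<partial>P)"
    by (rule emeasure_bind_binary_channel[OF l \<alpha> P]) simp
  also have "\<dots> = (\<integral>\<^sup>+x. ennreal ((1 + l x / z) / 2) \<partial>P)"
  proof (rule nn_integral_cong)
    fix x assume "x \<in> space P"
    then have x: "x \<in> space M" by (simp add: sp)
    have "prob_space (binary_channel M \<alpha> l x)"
      using measurable_space[OF binary_channel_measurable[OF l \<alpha>] x] by (simp add: space_prob_algebra)
    then interpret Q: prob_space "binary_channel M \<alpha> l x" .
    show "emeasure (binary_channel M \<alpha> l x) {z} = ennreal ((1 + l x / z) / 2)"
      unfolding Q.emeasure_eq_measure z_def binary_channel_masses(1)[OF l \<alpha> x y] ..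
  qed
  also have "\<dots> = ennreal (LINT x|P. (1 + l x / z) / 2)"
    using P.integrable_Linfty[OF lP] channel_prob_bounds(1)[OF l \<alpha> _ y]
    by (intro nn_integral_eq_integral) (auto simp: sp z_def)
  also have "(LINT x|P. (1 + l x / z) / 2) = (1 + (LINT x|P. l x) / z) / 2"
    using P.integrable_Linfty[OF lP] P.prob_space by simp
  moreover have "0 \<le> (LINT x|P. (1 + l x / z) / 2)"
    using channel_prob_bounds(1)[OF l \<alpha> _ y] by (intro integral_nonneg_AE) (auto simp: sp z_def)
  ultimately show ?thesis
    by (simp add: measure_def z_def)
qed

text \<open>The single event that the output is \<open>z = channel_level M \<alpha> l\<close>
  suffices: its probabilities under the two output laws differ by the difference of the integrals
  divided by \<open>2 * z\<close>.\<close>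

lemma abs_integral_diff_le_hellinger_dist_channel:
  assumes l: "l \<in> Linfty M" and \<alpha>: "0 < \<alpha>"
    and P0: "prob_space P0" "sets P0 = sets M" and P1: "prob_space P1" "sets P1 = sets M"
  shows "\<bar>(LINT x|P0. l x) - (LINT x|P1. l x)\<bar> \<le> 2 * channel_level M \<alpha> l *
    hellinger_dist (P0 \<bind> binary_channel M \<alpha> l) (P1 \<bind> binary_channel M \<alpha> l)"
proof (cases "\<forall>y\<in>space M. l y = 0")
  case True
  have sp: "space P0 = space M" "space P1 = space M"
    using P0(2) P1(2) by (auto dest: sets_eq_imp_space_eq)
  have "space M \<noteq> {}" using prob_space.not_empty[OF P0(1)] sp by simp
  \<comment> \<open>For vanishing \<open>l\<close> the channel is a point mass and its level is 0,
    so both sides of the inequality are 0.\<close>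
  with True have "sup_norm M l = 0" by (simp add: sup_norm_def)
  moreover have "(LINT x|P0. l x) = 0" "(LINT x|P1. l x) = 0"
    using True sp by (auto intro!: integral_eq_zero_AE)
  ultimately show ?thesis by (simp add: channel_level_def)
next
  case False
  then obtain y where y: "y \<in> space M" "l y \<noteq> 0" by blast
  define z where "z = channel_level M \<alpha> l"
  have z: "0 < z" using channel_level_gt(1)[OF l \<alpha> y] by (simp add: z_def)
  let ?Q = "binary_channel M \<alpha> l"
  have Q: "P \<bind> ?Q \<in> space (prob_algebra borel)" if "prob_space P" "sets P = sets M" for P
    using that prob_space_bind'[OF _ binary_channel_measurable[OF l \<alpha>], of P]
      sets_bind'[OF _ binary_channel_measurable[OF l \<alpha>], of P]
    by (simp add: space_prob_algebra)
  have "\<bar>measure (P0 \<bind> ?Q) {z} - measure (P1 \<bind> ?Q) {z}\<bar> \<le> hellinger_dist (P0 \<bind> ?Q) (P1 \<bind> ?Q)"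
    using Q[OF P0] Q[OF P1] by (intro measure_diff_le_hellinger_dist) (auto simp: space_prob_algebra)
  also have "measure (P0 \<bind> ?Q) {z} - measure (P1 \<bind> ?Q) {z}
      = ((LINT x|P0. l x) - (LINT x|P1. l x)) / (2 * z)"
    using z measure_bind_binary_channel[OF l \<alpha> P0 y] measure_bind_binary_channel[OF l \<alpha> P1 y]
    by (simp add: z_def field_simps)
  finally show ?thesis using z by (simp add: z_def field_simps)
qed

section \<open>Duality for the total variation modulus\<close>

lemma measure_mixture:
  assumes "finite_measure P" "finite_measure Q" "sets Q = sets P" "A \<in> sets P" "0 \<le> r" "r \<le> 1"
  shows "measure (mixture r P Q) A = r * measure P A + (1 - r) * measure Q A"
proof -
  interpret P: finite_measure P by fact
  interpret Q: finite_measure Q by fact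
  have "emeasure (mixture r P Q) A = ennreal (r * measure P A + (1 - r) * measure Q A)"
    using assms
    by (simp add: emeasure_mixture P.emeasure_eq_measure Q.emeasure_eq_measure ennreal_mult' ennreal_plus)
  then show ?thesis
    using assms(5,6) by (simp add: measure_def[of "mixture r P Q"] del: ennreal_plus)
qed

text \<open>The duality of L1 was proved over a finite measure. Passing to a measure with the same
  null sets preserves absolute continuity of the members of the family.\<close>

lemma (in sigma_finite_measure) obtain_equivalent_finite_measure:
  obtains N where "finite_measure N" "sets N = sets M" "null_sets N = null_sets M"
proof -
  obtain h :: "'a \<Rightarrow> real" where h: "h \<in> borel_measurable M" "\<And>x. 0 < h x" "integrable M h"
    using obtain_positive_integrable_function by metis
  define N where "N = density M (\<lambda>x. ennreal (h x))"
  have "emeasure N (space N) = (\<integral>\<^sup>+x. ennreal (h x) \<partial>M)"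
    using h(1) by (simp add: N_def emeasure_density cong: nn_integral_cong)
  also have "\<dots> = ennreal (LINT x|M. h x)"
    using h(3) less_imp_le[OF h(2)] by (intro nn_integral_eq_integral) auto
  finally have "finite_measure N" by (intro finite_measureI) simp
  moreover have "A \<in> null_sets N \<longleftrightarrow> A \<in> null_sets M" for A
  proof (cases "A \<in> sets M")
    case True
    have "A \<in> null_sets N \<longleftrightarrow> (AE x in M. x \<notin> A)"
      using h(1) True h(2)[THEN not_le[THEN iffD2]]
      by (simp add: N_def null_sets_density_iff ennreal_eq_0_iff)
    then show ?thesis using True by (simp add: AE_iff_null_sets)
  qed (auto simp: N_def null_sets_def)
  ultimately show thesis by (intro that[of N]) (auto simp: N_def)
qed

text \<open>The point is that one \<open>l\<close> serves all pairs at once. The condition on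
  \<open>\<theta>\<close> is stated without absolute value, since only the one-sided condition
  survives convex combinations of pairs.\<close>

lemma omega_TV_dual_function:
  fixes M \<mu> :: "'a measure"
  assumes P: "\<And>P. P \<in> \<P> \<Longrightarrow> prob_space P \<and> sets P = sets M"
    and convex: "convex_family \<P>"
    and \<mu>: "sigma_finite_measure \<mu>" "sets \<mu> = sets M"
    and ac: "\<And>P. P \<in> \<P> \<Longrightarrow> absolutely_continuous \<mu> P"
    and linear: "linear_functional_on \<P> \<theta>"
  shows "\<exists>l\<in>borel_measurable M. (\<forall>x. \<bar>l x\<bar> \<le> 1) \<and> (\<forall>P0\<in>\<P>. \<forall>P1\<in>\<P>.
    omega_TV \<P> \<theta> y < ereal (\<theta> P0 - \<theta> P1) \<longrightarrow> 2 * y \<le> (LINT x|P0. l x) - (LINT x|P1. l x))"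
proof -
  obtain N where "finite_measure N" and sN: "sets N = sets M" and null: "null_sets N = null_sets \<mu>"
    using sigma_finite_measure.obtain_equivalent_finite_measure[OF \<mu>(1)] \<mu>(2) by metis
  interpret N: finite_measure N by fact
  have sp: "space N = space M" using sN by (rule sets_eq_imp_space_eq)
  let ?W = "omega_TV \<P> \<theta> y"
  \<comment> \<open>\<open>f\<close> is a density of \<open>P0 - P1\<close>, expressed through
    integrals over sets; convexity then follows from linearity without choosing densities of the
    single measures.\<close>
  define K where "K = {f. integrable N f \<and> (\<exists>P0\<in>\<P>. \<exists>P1\<in>\<P>. ?W < ereal (\<theta> P0 - \<theta> P1) \<and>
    (\<forall>A\<in>sets M. (LINT x|N. indicator A x * f x) = measure P0 A - measure P1 A))}"
  have ind: "integrable N (\<lambda>x. indicator A x * f x)"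
    if "integrable N f" "A \<in> sets M" for f :: "'a \<Rightarrow> real" and A
    using integrable_mult_indicator[of A N f] that sN by simp
  have "convex K"
  proof (rule convexI)
    fix f g and u v :: real
    assume f: "f \<in> K" and g: "g \<in> K" and uv: "0 \<le> u" "0 \<le> v" "u + v = 1"
    obtain P0 P1 where P01: "P0 \<in> \<P>" "P1 \<in> \<P>" "?W < ereal (\<theta> P0 - \<theta> P1)"
      "\<And>A. A \<in> sets M \<Longrightarrow> (LINT x|N. indicator A x * f x) = measure P0 A - measure P1 A"
      using f by (auto simp: K_def)
    obtain Q0 Q1 where Q01: "Q0 \<in> \<P>" "Q1 \<in> \<P>" "?W < ereal (\<theta> Q0 - \<theta> Q1)"
      "\<And>A. A \<in> sets M \<Longrightarrow> (LINT x|N. indicator A x * g x) = measure Q0 A - measure Q1 A"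
      using g by (auto simp: K_def)
    have fg: "integrable N f" "integrable N g" using f g by (auto simp: K_def)
    have u: "u \<in> {0..1}" "v = 1 - u" using uv by auto
    let ?R0 = "mixture u P0 Q0" and ?R1 = "mixture u P1 Q1"
    have R: "?R0 \<in> \<P>" "?R1 \<in> \<P>"
      using convex P01 Q01 u by (auto simp: convex_family_def)
    have "\<theta> ?R0 = u * \<theta> P0 + v * \<theta> Q0" "\<theta> ?R1 = u * \<theta> P1 + v * \<theta> Q1"
      using linear P01(1,2) Q01(1,2) u by (auto simp: linear_functional_on_def)
    then have "\<theta> ?R0 - \<theta> ?R1 = u * (\<theta> P0 - \<theta> P1) + v * (\<theta> Q0 - \<theta> Q1)"
      by (simp add: algebra_simps)
    \<comment> \<open>Bounding by the smaller of two real differences avoids arithmetic with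
      \<open>?W\<close>, which may be infinite.\<close>
    also have "\<dots> \<ge> u * min (\<theta> P0 - \<theta> P1) (\<theta> Q0 - \<theta> Q1) + v * min (\<theta> P0 - \<theta> P1) (\<theta> Q0 - \<theta> Q1)"
      using uv by (intro add_mono mult_left_mono) auto
    finally have "min (\<theta> P0 - \<theta> P1) (\<theta> Q0 - \<theta> Q1) \<le> \<theta> ?R0 - \<theta> ?R1"
      using uv(3) by (simp flip: distrib_right)
    then have "?W < ereal (\<theta> ?R0 - \<theta> ?R1)"
      using P01(3) Q01(3) by (metis ereal_less_eq(3) less_le_trans min_def)
    moreover have "(LINT x|N. indicator A x * (u *\<^sub>R f + v *\<^sub>R g) x) = measure ?R0 A - measure ?R1 A"
      if A: "A \<in> sets M" for A
    proof -
      have mix: "measure (mixture u P' Q') A = u * measure P' A + v * measure Q' A"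
        if "P' \<in> \<P>" "Q' \<in> \<P>" for P' Q'
        using measure_mixture[of P' Q' A u] P[OF that(1)] P[OF that(2)] A u
        by (simp add: prob_space.finite_measure)
      have "(LINT x|N. indicator A x * (u *\<^sub>R f + v *\<^sub>R g) x)
          = (LINT x|N. u * (indicator A x * f x) + v * (indicator A x * g x))"
        by (simp add: plus_fun_def scaleR_fun_def algebra_simps)
      also have "\<dots> = u * (measure P0 A - measure P1 A) + v * (measure Q0 A - measure Q1 A)"
        using ind[OF fg(1) A] ind[OF fg(2) A] P01(4)[OF A] Q01(4)[OF A] by simp
      finally show ?thesis
        using P01(1,2) Q01(1,2) by (simp add: mix algebra_simps)
    qed
    moreover have "integrable N (u *\<^sub>R f + v *\<^sub>R g)"
      using fg by (simp add: plus_fun_def scaleR_fun_def)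
    ultimately show "u *\<^sub>R f + v *\<^sub>R g \<in> K" using R unfolding K_def by blast
  qed
  moreover have "2 * y \<le> (LINT x|N. \<bar>f x\<bar>)" if f: "f \<in> K" for f
  proof (rule ccontr)
    assume less: "\<not> 2 * y \<le> (LINT x|N. \<bar>f x\<bar>)"
    obtain P0 P1 where P01: "P0 \<in> \<P>" "P1 \<in> \<P>" "?W < ereal (\<theta> P0 - \<theta> P1)"
      "\<And>A. A \<in> sets M \<Longrightarrow> (LINT x|N. indicator A x * f x) = measure P0 A - measure P1 A"
      using f by (auto simp: K_def)
    have int: "integrable N f" using f by (simp add: K_def)
    have "measure P0 (space M) = 1" "measure P1 (space M) = 1"
      using P[OF P01(1)] P[OF P01(2)] by (metis prob_space.prob_space sets_eq_imp_space_eq)+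
    then have "(LINT x|N. f x) = 0"
      using P01(4)[of "space M"] sets.top[of M]
      by (simp flip: sp cong: Bochner_Integration.integral_cong)
    then have "\<bar>measure P0 A - measure P1 A\<bar> \<le> y" if "A \<in> sets P0" for A
      using abs_integral_indicator_le[OF int, of A] that less P[OF P01(1)] sN P01(4)[of A] by simp
    then have "tv_dist P0 P1 \<le> y"
      unfolding tv_dist_def by (intro cSUP_least) auto
    then have "ereal \<bar>\<theta> P0 - \<theta> P1\<bar> \<le> ?W"
      unfolding omega_TV_def using P01(1,2) by (intro Sup_upper) blast
    moreover have "ereal (\<theta> P0 - \<theta> P1) \<le> ereal \<bar>\<theta> P0 - \<theta> P1\<bar>" by simp
    ultimately show False using P01(3) by (meson leD order_trans)
  qed
  ultimately obtain l where l: "l \<in> borel_measurable N" "\<And>x. \<bar>l x\<bar> \<le> 1"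
    and sep: "\<And>f. f \<in> K \<Longrightarrow> 2 * y \<le> (LINT x|N. l x * f x)"
    using N.L1_separation[of K "2 * y"] by (auto simp: K_def)
  have "2 * y \<le> (LINT x|P0. l x) - (LINT x|P1. l x)"
    if P01: "P0 \<in> \<P>" "P1 \<in> \<P>" "?W < ereal (\<theta> P0 - \<theta> P1)" for P0 P1
  proof -
    have ex: "\<exists>D :: 'a \<Rightarrow> real. integrable N D \<and> (\<forall>x. 0 \<le> D x) \<and> P' = density N (\<lambda>x. ennreal (D x))"
      if P': "P' \<in> \<P>" for P'
    proof -
      have "absolutely_continuous N P'" using ac[OF P'] by (simp add: absolutely_continuous_def null)
      then show ?thesis
        using N.finite_measure_density_exists[of P'] P[OF P'] sN
        by (metis prob_space.finite_measure)
    qed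
    obtain D0 where D0: "integrable N D0" "\<And>x. 0 \<le> D0 x" "P0 = density N (\<lambda>x. ennreal (D0 x))"
      using ex[OF P01(1)] by auto
    obtain D1 where D1: "integrable N D1" "\<And>x. 0 \<le> D1 x" "P1 = density N (\<lambda>x. ennreal (D1 x))"
      using ex[OF P01(2)] by auto
    have "(LINT x|N. indicator A x * (D0 x - D1 x)) = measure P0 A - measure P1 A"
      if A: "A \<in> sets M" for A
      using ind[OF D0(1) A] ind[OF D1(1) A] A sN D0 D1
      by (simp add: measure_density_real right_diff_distrib)
    \<comment> \<open>Individual densities enter only here, to turn the integral against
      \<open>f\<close> back into integrals under \<open>P0\<close> and \<open>P1\<close>.\<close>
    then have "(\<lambda>x. D0 x - D1 x) \<in> K" unfolding K_def using D0(1) D1(1) P01 by auto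
    then have "2 * y \<le> (LINT x|N. l x * (D0 x - D1 x))" by (rule sep)
    also have "\<dots> = (LINT x|N. D0 x * l x) - (LINT x|N. D1 x * l x)"
    proof -
      have "integrable N (\<lambda>x. D x * l x)" if "integrable N D" for D
      proof (rule Bochner_Integration.integrable_bound[OF that])
        show "(\<lambda>x. D x * l x) \<in> borel_measurable N" using that l(1) by measurable
        show "AE x in N. norm (D x * l x) \<le> norm (D x)"
          using l(2) by (auto simp: abs_mult intro!: mult_right_le_one_le)
      qed
      then show ?thesis using D0(1) D1(1) by (simp add: algebra_simps)
    qed
    also have "\<dots> = (LINT x|P0. l x) - (LINT x|P1. l x)"
      using D0 D1 l(1) by (simp add: integral_density)
    finally show ?thesis .
  qed
  moreover have "l \<in> borel_measurable M" using l(1) sN by (simp cong: measurable_cong_sets)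
  ultimately show ?thesis using l(2) by blast
qed

section \<open>Choice of the channel and passage to the right limit\<close>

theorem theorem4p2:
  fixes M \<mu> :: "'a measure" and \<P> :: "'a measure set" and \<theta> :: "'a measure \<Rightarrow> real"
    and \<alpha> \<epsilon> :: real
  assumes "\<P> \<noteq> {}"
    and "\<And>P. P \<in> \<P> \<Longrightarrow> prob_space P \<and> sets P = sets M"
    and "convex_family \<P>"
    and "sigma_finite_measure \<mu>" and "sets \<mu> = sets M"
    and "\<And>P. P \<in> \<P> \<Longrightarrow> absolutely_continuous \<mu> P"
    and "linear_functional_on \<P> \<theta>"
    and "0 < \<alpha>" and "0 < \<epsilon>"
  shows "(INF l\<in>{l \<in> Linfty M. sup_norm M l \<le> 1}. omega_H \<P> \<theta> (binary_channel M \<alpha> l) \<epsilon>)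
    \<le> right_limit (omega_TV \<P> \<theta>) (\<epsilon> * ((exp \<alpha> + 1) / (exp \<alpha> - 1)))"
    (is "?I \<le> right_limit _ ?x")
proof (rule tendsto_lowerbound[OF tendsto_right_limit_mono[OF mono_omega_TV]])
  have ne: "space M \<noteq> {}"
    using assms(1,2) by (metis all_not_in_conv prob_space.not_empty sets_eq_imp_space_eq)
  \<comment> \<open>A bound for all \<open>y\<close> strictly above \<open>?x\<close> passes to the
    right limit, and the strictness produces the contradiction with \<open>2 * y\<close>
    below.\<close>
  have "?I \<le> omega_TV \<P> \<theta> y" if y: "?x < y" for y
  proof -
    obtain l where l: "l \<in> borel_measurable M" "\<And>x. \<bar>l x\<bar> \<le> 1"
      and sep: "\<And>P0 P1. P0 \<in> \<P> \<Longrightarrow> P1 \<in> \<P> \<Longrightarrow> omega_TV \<P> \<theta> y < ereal (\<theta> P0 - \<theta> P1) \<Longrightarrow>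
        2 * y \<le> (LINT x|P0. l x) - (LINT x|P1. l x)"
      using omega_TV_dual_function[OF assms(2-7), of y] by auto
    have lL: "l \<in> Linfty M" using l by (auto simp: Linfty_def bounded_real)
    have l1: "sup_norm M l \<le> 1"
      unfolding sup_norm_def using ne l(2) by (intro cSUP_least) auto
    have "omega_H \<P> \<theta> (binary_channel M \<alpha> l) \<epsilon> \<le> omega_TV \<P> \<theta> y"
      unfolding omega_H_def
    proof (rule Sup_least, clarify)
      fix P0 P1
      assume P: "P0 \<in> \<P>" "P1 \<in> \<P>"
        and H: "hellinger_dist (P0 \<bind> binary_channel M \<alpha> l) (P1 \<bind> binary_channel M \<alpha> l) \<le> \<epsilon>"
      have c: "0 < (exp \<alpha> + 1) / (exp \<alpha> - 1)" using assms(8) by (simp add: add_pos_pos)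
      obtain x where "x \<in> space M" using ne by auto
      then have "0 \<le> sup_norm M l" using abs_le_sup_norm[OF lL] abs_ge_zero order_trans by blast
      then have z: "0 \<le> channel_level M \<alpha> l" "channel_level M \<alpha> l \<le> (exp \<alpha> + 1) / (exp \<alpha> - 1)"
        using mult_nonneg_nonneg[of "sup_norm M l", OF _ less_imp_le[OF c]]
          mult_right_mono[OF l1 less_imp_le[OF c]]
        by (auto simp: channel_level_def)
      have "\<bar>(LINT x|P0. l x) - (LINT x|P1. l x)\<bar> \<le> 2 * channel_level M \<alpha> l *
          hellinger_dist (P0 \<bind> binary_channel M \<alpha> l) (P1 \<bind> binary_channel M \<alpha> l)"
        using assms(2)[OF P(1)] assms(2)[OF P(2)]
        by (intro abs_integral_diff_le_hellinger_dist_channel lL assms(8)) auto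
      also have "\<dots> \<le> 2 * channel_level M \<alpha> l * \<epsilon>"
        using H z(1) by (intro mult_left_mono) auto
      also have "\<dots> \<le> 2 * ?x"
        using mult_left_mono[OF z(2), of "2 * \<epsilon>"] assms(9) by (simp only: mult_ac)
      also have "\<dots> < 2 * y" using y by simp
      \<comment> \<open>Since the bound on the integrals is symmetric, \<open>sep\<close> can be
        refuted for the pair in both orders, which restores the absolute value of the difference of
        \<open>\<theta>\<close>.\<close>
      finally have "\<not> omega_TV \<P> \<theta> y < ereal (\<theta> P0 - \<theta> P1)" "\<not> omega_TV \<P> \<theta> y < ereal (\<theta> P1 - \<theta> P0)"
        using sep[OF P] sep[OF P(2,1)] by auto
      then show "ereal \<bar>\<theta> P0 - \<theta> P1\<bar> \<le> omega_TV \<P> \<theta> y"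
        by (cases "\<theta> P0 \<le> \<theta> P1") (auto simp: not_less)
    qed
    then show ?thesis using lL l1 by (intro INF_lower2[of l]) auto
  qed
  then show "\<forall>\<^sub>F y in at_right ?x. ?I \<le> omega_TV \<P> \<theta> y"
    by (auto simp: eventually_at_filter)
qed simp

end
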